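(* Let $V$ be an $m$-dimensional Euclidean vector space, $I\subset\mathbb{R}$ an interval, and $R(t)$, $t\in I$, a smooth family of symmetric endomorphisms of $V$. Let $\mathrm{Jac}$ be the symplectic vector space of solutions of the Jacobi equation $Y''(t)+R(t)Y(t)=0$ on $I$. Then for any Lagrangian subspaces $\Lambda_1,\Lambda_2\subset\mathrm{Jac}$ and any interval $I_0\subset I$ we have $$\mathrm{ind}_{\Lambda_1}(I_0)-\mathrm{ind}_{\Lambda_2}(I_0)\le\dim(V)-\dim(\Lambda_1\cap\Lambda_2).$$
   Context: $\mathrm{Jac}$ denotes the vector space of all solutions $J:I\to V$ (Jacobi fields) of $Y''(t)+R(t)Y(t)=0$; it carries the symplectic form $\omega(J_1,J_2)=\langle J_1(t),J_2'(t)\rangle-\langle J_1'(t),J_2(t)\rangle$, which is independent of $t\in I$. For a subspace $W\subset \mathrm{Jac}$, $W^{\perp}$ is the orthogonal complement of $W$ with respect to $\omega$; $W$ is isotropic if $W\subset W^\perp$ and Lagrangian if $W=W^\perp$. For isotropic $W$ and $t\in I$ set $W(t)=\{J(t)\mid J\in W\}$ and $W^t=\{J\in W\mid J(t)=0\}$, and define the $W$-focal index $f^W(t)=\dim(W^t)=\dim(W)-\dim(W(t))$. For a subinterval $I_0\subset I$ the $W$-index of $I_0$ is $\mathrm{ind}_W(I_0)=\sum_{t\in I_0} f^W(t)$. *)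

theory Defs
  imports "HOL-Analysis.Analysis" "HOL-Library.Function_Algebras"
begin

instantiation "fun" :: (type, real_vector) real_vector
begin

definition scaleR_fun :: "real \<Rightarrow> ('a \<Rightarrow> 'b) \<Rightarrow> 'a \<Rightarrow> 'b"
  where "scaleR_fun c f = (\<lambda>x. c *\<^sub>R f x)"

instance
  by standard (auto simp: scaleR_fun_def fun_eq_iff scaleR_add_right scaleR_add_left)

end

(* The derivative relative to I: one-sided at an endpoint of I that belongs to I. *)
definition deriv_on :: "real set \<Rightarrow> (real \<Rightarrow> 'v::real_normed_vector) \<Rightarrow> real \<Rightarrow> 'v"
  where "deriv_on I f = (\<lambda>t. vector_derivative f (at t within I))"

definition smooth_on :: "real set \<Rightarrow> (real \<Rightarrow> 'v::real_normed_vector) \<Rightarrow> bool"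
  where "smooth_on I f \<longleftrightarrow> (\<forall>k::nat. (deriv_on I ^^ k) f differentiable_on I)"

(* Maps I \<rightarrow> V are represented by functions on the reals that vanish outside I, so that each
   Jacobi field has exactly one representative. *)
definition Jac :: "real set \<Rightarrow> (real \<Rightarrow> 'v::euclidean_space \<Rightarrow>\<^sub>L 'v) \<Rightarrow> (real \<Rightarrow> 'v) set"
  where "Jac I R = {J. (\<forall>t. t \<notin> I \<longrightarrow> J t = 0) \<and>
     J differentiable_on I \<and> deriv_on I J differentiable_on I \<and>
     (\<forall>t\<in>I. deriv_on I (deriv_on I J) t + blinfun_apply (R t) (J t) = 0)}"

definition omega_at :: "real set \<Rightarrow> real \<Rightarrow> (real \<Rightarrow> 'v::euclidean_space) \<Rightarrow> (real \<Rightarrow> 'v) \<Rightarrow> real"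
  where "omega_at I t J K = J t \<bullet> deriv_on I K t - deriv_on I J t \<bullet> K t"

(* The choice of the point of I is immaterial on Jacobi fields, see omega_eq below. *)
definition omega :: "real set \<Rightarrow> (real \<Rightarrow> 'v::euclidean_space) \<Rightarrow> (real \<Rightarrow> 'v) \<Rightarrow> real"
  where "omega I = omega_at I (SOME t. t \<in> I)"

definition omega_compl ::
    "real set \<Rightarrow> (real \<Rightarrow> 'v::euclidean_space \<Rightarrow>\<^sub>L 'v) \<Rightarrow> (real \<Rightarrow> 'v) set \<Rightarrow> (real \<Rightarrow> 'v) set"
  where "omega_compl I R W = {J \<in> Jac I R. \<forall>K\<in>W. omega I J K = 0}"

definition lagrangian ::
    "real set \<Rightarrow> (real \<Rightarrow> 'v::euclidean_space \<Rightarrow>\<^sub>L 'v) \<Rightarrow> (real \<Rightarrow> 'v) set \<Rightarrow> bool"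
  where "lagrangian I R W \<longleftrightarrow> subspace W \<and> W \<subseteq> Jac I R \<and> W = omega_compl I R W"

definition focal_index :: "(real \<Rightarrow> 'v::euclidean_space) set \<Rightarrow> real \<Rightarrow> nat"
  where "focal_index W t = dim {J \<in> W. J t = 0}"

(* The sum of nonnegative terms is taken in the extended reals, since it can be infinite when
   I0 is not compact (e.g. R = id and I0 the whole real line). *)
definition ind :: "(real \<Rightarrow> 'v::euclidean_space) set \<Rightarrow> real set \<Rightarrow> ereal"
  where "ind W I0 = (\<Sum>\<^sub>\<infinity>t\<in>I0. ereal (real (focal_index W t)))"

lemma deriv_on_works:
  assumes "f differentiable_on I" "t \<in> I"
  shows "(f has_vector_derivative deriv_on I f t) (at t within I)"
  using assms by (simp add: deriv_on_def differentiable_on_def vector_derivative_works)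

lemma omega_at_const:
  fixes R :: "real \<Rightarrow> 'v::euclidean_space \<Rightarrow>\<^sub>L 'v"
  assumes I: "is_interval I"
    and sym: "\<And>t x y. t \<in> I \<Longrightarrow> R t x \<bullet> y = x \<bullet> R t y"
    and J: "J \<in> Jac I R" and K: "K \<in> Jac I R" and "s \<in> I" "t \<in> I"
  shows "omega_at I s J K = omega_at I t J K"
proof -
  have "\<exists>c. \<forall>x\<in>I. omega_at I x J K = c"
  proof (rule has_derivative_zero_constant)
    show "convex I" using I by (simp add: is_interval_convex)
    fix x assume x: "x \<in> I"
    let ?D = "deriv_on I"
    have eq: "?D (?D J) x = - R x (J x)" "?D (?D K) x = - R x (K x)"
      using J K x by (simp_all add: Jac_def eq_neg_iff_add_eq_0)
    have d: "(J has_vector_derivative ?D J x) (at x within I)"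
      "(K has_vector_derivative ?D K x) (at x within I)"
      "(?D J has_vector_derivative - R x (J x)) (at x within I)"
      "(?D K has_vector_derivative - R x (K x)) (at x within I)"
      unfolding eq[symmetric] using J K x by (auto intro!: deriv_on_works simp: Jac_def)
    have 1: "((\<lambda>x. J x \<bullet> ?D K x) has_vector_derivative
        J x \<bullet> (- R x (K x)) + ?D J x \<bullet> ?D K x) (at x within I)"
      using bounded_bilinear.has_vector_derivative[OF bounded_bilinear_inner d(1) d(4)] .
    have 2: "((\<lambda>x. ?D J x \<bullet> K x) has_vector_derivative
        ?D J x \<bullet> ?D K x + (- R x (J x)) \<bullet> K x) (at x within I)"
      using bounded_bilinear.has_vector_derivative[OF bounded_bilinear_inner d(3) d(2)] .
    have "((\<lambda>x. omega_at I x J K) has_vector_derivative 0) (at x within I)"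
      unfolding omega_at_def using sym[OF x]
      by (auto intro!: derivative_eq_intros 1 2 simp: inner_simps)
    then show "((\<lambda>x. omega_at I x J K) has_derivative (\<lambda>h. 0)) (at x within I)"
      by (simp add: has_vector_derivative_def)
  qed
  then show ?thesis using assms by auto
qed

lemma omega_eq:
  fixes R :: "real \<Rightarrow> 'v::euclidean_space \<Rightarrow>\<^sub>L 'v"
  assumes "is_interval I" "\<And>t x y. t \<in> I \<Longrightarrow> R t x \<bullet> y = x \<bullet> R t y"
    and "J \<in> Jac I R" "K \<in> Jac I R" "t \<in> I"
  shows "omega I J K = J t \<bullet> deriv_on I K t - deriv_on I J t \<bullet> K t"
proof -
  have "(SOME t. t \<in> I) \<in> I" using assms(5) by (rule someI)
  then show ?thesis
    unfolding omega_def omega_at_def[symmetric] using omega_at_const[OF assms(1-4)] assms(5) by blast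
qed

end

(* For a Jacobi field y put g(t) = omega(y, j), where j is any element of L2 with j(t) = y(t); away from
   the focal points of L2 this is the Riccati expression <U y - y', y>, U being the shape operator of L2.
   It satisfies g' = - |y' - j'|^2 at non-focal t, extends continuously through a focal point t
   whenever y(t) lies in L2(t), and does not jump when a field from L1 vanishing at t is added to y in L1.

   Take J_t in L1 with J_t(t) = 0 for finitely many t, and let X(t) be the sum of the J_s with s >= t.
   If the sum of all J_s is in L2, and X(t) is in L2(t) at every focal point t of L2, then g decreases
   from 0 to 0 along X, so each piece of X, and hence each J_t, is in L2. These are linear conditions: at
   most dim V - dim (L1 cap L2) of the first kind and dim (L2^t) - dim ((L1 cap L2)^t) at each t
   of the second, since L1(t) is orthogonal to the derivatives of (L1 cap L2)^t. Counting unknowns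
   modulo (L1 cap L2)^t gives the claim. *)
theory Submission
  imports Defs
begin

text \<open>The obstacle is a focal point t0 of L2, where the shape operator is undefined and
  evaluation on L2 is not injective. Continuity of g there rests on one estimate: for p in L2 and t
  near t0, the norm of p(t0) is at most C times that of p(t). It holds because L2(t0) is orthogonal
  to the derivatives at t0 of the fields of L2 vanishing there. The two zeros of g have different
  origins: beyond the last break X is the empty sum, before the first one it is the total, which
  lies in L2. Between them y' = j' at non-focal points, so y and j share their Cauchy data at such a
  point and coincide. The function space of Jacobi fields carries no inner product, so the work is
  done on Cauchy data in V x V, where orthogonal complements represent quotients. Existence and
  uniqueness for the initial value problem make this a faithful model, in which Lagrangian subspaces
  have dimension dim V. Finitely many times suffice: a finite index of L2 leaves only finitely many
  focal points in I0, and the index of L1 is a supremum over finite sets of times.\<close>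

subsection \<open>Linear differential equations on intervals\<close>

text \<open>Lets a derivative within \<open>I\<close> be computed on a compact subinterval, where
  continuous coefficients are bounded. On each side where \<open>I\<close> continues, an endpoint is
  placed strictly beyond \<open>t\<close>, so the filter at \<open>t\<close> does not
  change.\<close>

lemma at_within_interval_compact:
  fixes I :: "real set"
  assumes I: "is_interval I" and t: "t \<in> I" and s: "s \<in> I"
  obtains a b where "{a..b} \<subseteq> I" "t \<in> {a..b}" "s \<in> {a..b}" "at t within {a..b} = at t within I"
proof -
  obtain a where a: "a \<in> I" "a \<le> t" "a \<le> s" "a < t \<or> (\<forall>x\<in>I. a \<le> x)"
  proof (cases "\<exists>x\<in>I. x < t")
    case True
    then obtain x where "x \<in> I" "x < t" by blast
    then show ?thesis using s by (intro that[of "min x s"]) (auto simp: min_def)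
  next
    case False
    then show ?thesis using s t by (intro that[of t]) (auto simp: not_less)
  qed
  obtain b where b: "b \<in> I" "t \<le> b" "s \<le> b" "t < b \<or> (\<forall>x\<in>I. x \<le> b)"
  proof (cases "\<exists>x\<in>I. t < x")
    case True
    then obtain x where "x \<in> I" "t < x" by blast
    then show ?thesis using s by (intro that[of "max x s"]) (auto simp: max_def)
  next
    case False
    then show ?thesis using s t by (intro that[of t]) (auto simp: not_less)
  qed
  have sub: "{a..b} \<subseteq> I"
    using mem_is_interval_1_I[OF I a(1) b(1)] by auto
  \<comment> \<open>If \<open>t\<close> is an end of \<open>I\<close>, nothing of \<open>I\<close>
    lies beyond it and the window may pass \<open>t\<close> by any amount; 1 is arbitrary.\<close>
  let ?l = "if a < t then a else t - 1" and ?h = "if t < b then b else t + 1"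
  have "at t within {a..b} = at t within I"
  proof (rule at_within_nhd[of t "{?l<..<?h}"])
    show "{a..b} \<inter> {?l<..<?h} - {t} = I \<inter> {?l<..<?h} - {t}"
    proof (intro set_eqI iffI)
      fix x assume x: "x \<in> I \<inter> {?l<..<?h} - {t}"
      have "a \<le> x" using x a(4) by (cases "a < t") auto
      moreover have "x \<le> b" using x b(4) by (cases "t < b") auto
      ultimately show "x \<in> {a..b} \<inter> {?l<..<?h} - {t}" using x by auto
    qed (use sub in auto)
  qed auto
  then show thesis using that sub a b by auto
qed

text \<open>Gronwall by energy: the derivative of |u|^2 is at most 2 M |u|^2 in absolute value, so
  |u|^2 exp(-2 M x) is nonincreasing to the right of \<open>s\<close> and |u|^2 exp(2 M x) is
  nondecreasing to the left of it.\<close>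

lemma linear_ode_unique:
  fixes A :: "real \<Rightarrow> 'a::euclidean_space \<Rightarrow>\<^sub>L 'a"
  assumes A: "continuous_on {a..b} A"
    and u: "\<And>t. t \<in> {a..b} \<Longrightarrow> (u has_vector_derivative A t (u t)) (at t within {a..b})"
    and s: "s \<in> {a..b}" "u s = 0" and t: "t \<in> {a..b}"
  shows "u t = 0"
proof -
  have "bounded (A ` {a..b})"
    using compact_continuous_image[OF A] compact_imp_bounded by blast
  then obtain M where M: "\<And>x. x \<in> {a..b} \<Longrightarrow> norm (A x) \<le> M"
    unfolding bounded_iff by blast
  have b: "\<bar>u x \<bullet> A x (u x)\<bar> \<le> M * (u x \<bullet> u x)" if "x \<in> {a..b}" for x
  proof -
    have "\<bar>u x \<bullet> A x (u x)\<bar> \<le> norm (u x) * (norm (A x) * norm (u x))"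
      using Cauchy_Schwarz_ineq2[of "u x" "A x (u x)"] norm_blinfun[of "A x" "u x"]
      by (meson mult_left_mono norm_ge_zero order_trans)
    also have "\<dots> \<le> norm (u x) * (M * norm (u x))"
      by (intro mult_left_mono mult_right_mono M that) auto
    finally show ?thesis by (simp add: dot_square_norm power2_eq_square mult_ac)
  qed
  define f where "f k x = (u x \<bullet> u x) * exp (k * x)" for k x
  have f: "(f k has_real_derivative (2 * (u x \<bullet> A x (u x)) + k * (u x \<bullet> u x)) * exp (k * x))
      (at x within {a..b})" if "x \<in> {a..b}" for k x
  proof -
    have "((\<lambda>x. u x \<bullet> u x) has_vector_derivative u x \<bullet> A x (u x) + A x (u x) \<bullet> u x) (at x within {a..b})"
      using bounded_bilinear.has_vector_derivative[OF bounded_bilinear_inner u[OF that] u[OF that]] .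
    then have "((\<lambda>x. u x \<bullet> u x) has_real_derivative 2 * (u x \<bullet> A x (u x))) (at x within {a..b})"
      by (simp add: has_real_derivative_iff_has_vector_derivative inner_commute)
    then show ?thesis unfolding f_def
      by (auto intro!: derivative_eq_intros simp: algebra_simps)
  qed
  have fc: "continuous_on {x..y} (f k)" if "a \<le> x" "y \<le> b" for x y k
  proof (rule continuous_on_subset)
    show "continuous_on {a..b} (f k)" by (rule DERIV_continuous_on) (rule f)
  qed (use that in auto)
  have fi: "(f k has_real_derivative (2 * (u x \<bullet> A x (u x)) + k * (u x \<bullet> u x)) * exp (k * x)) (at x)"
    if "x \<in> {a<..<b}" for k x
    using f[of x k] that at_within_Icc_at[of a x b] by auto
  have "f k t \<le> 0" if k: "k = (if s \<le> t then - 2 * M else 2 * M)" for k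
  proof (cases "s \<le> t")
    case True
    have "f k t \<le> f k s"
    proof (rule DERIV_nonpos_imp_decreasing_open[OF True, where f = "f k"])
      fix x assume x: "s < x" "x < t"
      then have "2 * (u x \<bullet> A x (u x)) + k * (u x \<bullet> u x) \<le> 0"
        using b[of x] s t k True by auto
      then show "\<exists>y. (f k has_real_derivative y) (at x) \<and> y \<le> 0"
        using fi[of x k] x s t by (auto intro!: exI mult_nonpos_nonneg)
    qed (use fc s t in auto)
    then show ?thesis using s by (simp add: f_def)
  next
    case False
    have "f k t \<le> f k s"
    proof (rule DERIV_nonneg_imp_increasing_open[where f = "f k"])
      fix x assume x: "t < x" "x < s"
      then have "2 * (u x \<bullet> A x (u x)) + k * (u x \<bullet> u x) \<ge> 0"
        using b[of x] s t k False by auto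
      then show "\<exists>y. (f k has_real_derivative y) (at x) \<and> y \<ge> 0"
        using fi[of x k] x s t by (auto intro!: exI)
    qed (use fc s t False in auto)
    then show ?thesis using s by (simp add: f_def)
  qed
  from this[OF refl] have "u t \<bullet> u t \<le> 0"
    by (simp add: f_def mult_le_0_iff)
  then show ?thesis using inner_gt_zero_iff[of "u t"] by fastforce
qed

text \<open>Picard iteration as a series: \<open>v n\<close> is the n-th iterated integral of
  \<open>A\<close> starting from the constant \<open>c\<close>, and is dominated by the n-th term of
  an exponential series.\<close>

lemma linear_ode_exists_left:
  fixes A :: "real \<Rightarrow> 'a::euclidean_space \<Rightarrow>\<^sub>L 'a"
  assumes A: "continuous_on {a..b} A" and ab: "a \<le> b"
  shows "\<exists>u. u a = c \<and> (\<forall>t\<in>{a..b}. (u has_vector_derivative A t (u t)) (at t within {a..b}))"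
proof -
  have "bounded (A ` {a..b})"
    using compact_continuous_image[OF A] compact_imp_bounded by blast
  then obtain M where M: "\<And>x. x \<in> {a..b} \<Longrightarrow> norm (A x) \<le> M"
    unfolding bounded_iff by blast
  have M0: "M \<ge> 0" using order_trans[OF norm_ge_zero M[of a]] ab by simp
  define v where "v = rec_nat (\<lambda>_. c) (\<lambda>n w t. integral {a..t} (\<lambda>s. A s (w s)))"
  have v0: "v 0 = (\<lambda>_. c)" and vS: "v (Suc n) = (\<lambda>t. integral {a..t} (\<lambda>s. A s (v n s)))" for n
    by (simp_all add: v_def)
  have vc: "continuous_on {a..b} (v n)" for n
  proof (induction n)
    case (Suc n)
    show ?case unfolding vS
      by (intro indefinite_integral_continuous_1 integrable_continuous_real continuous_intros A Suc)
  qed (simp add: v0)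
  have Avc: "continuous_on {a..b} (\<lambda>s. A s (v n s))" for n
    by (intro continuous_intros A vc)
  have vd: "(v (Suc n) has_vector_derivative A t (v n t)) (at t within {a..b})" if "t \<in> {a..b}" for n t
    unfolding vS by (rule integral_has_vector_derivative[OF Avc that])
  have bound: "norm (v n t) \<le> norm c * (M * (t - a)) ^ n / fact n" if "t \<in> {a..b}" for n t
    using that
  proof (induction n arbitrary: t)
    case (Suc n)
    let ?p = "\<lambda>n s. norm c * (M * (s - a)) ^ n / fact n"
    have p: "((\<lambda>s. M * ?p n s) has_integral ?p (Suc n) t - ?p (Suc n) a) {a..t}"
    proof (rule fundamental_theorem_of_calculus)
      fix x
      have "((\<lambda>s. M * (s - a)) has_real_derivative M) (at x within {a..t})"
        by (auto intro!: derivative_eq_intros)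
      from DERIV_cdivide[OF DERIV_cmult[OF DERIV_power[OF this, of "Suc n"], of "norm c"], of "fact (Suc n)"]
      have "(?p (Suc n) has_real_derivative
          norm c * (real (Suc n) * (M * (M * (x - a)) ^ n)) / fact (Suc n)) (at x within {a..t})"
        by (simp only: diff_Suc_Suc diff_zero)
      moreover have "norm c * (real (Suc n) * (M * (M * (x - a)) ^ n)) / fact (Suc n) = M * ?p n x"
        by (simp add: divide_simps)
      ultimately show "(?p (Suc n) has_vector_derivative M * ?p n x) (at x within {a..t})"
        by (simp only: has_real_derivative_iff_has_vector_derivative)
    qed (use Suc.prems in auto)
    have "norm (v (Suc n) t) \<le> integral {a..t} (\<lambda>s. M * ?p n s)"
      unfolding vS
    proof (rule integral_norm_bound_integral)
      show "(\<lambda>s. A s (v n s)) integrable_on {a..t}"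
        using Suc.prems by (intro integrable_continuous_real continuous_on_subset[OF Avc]) auto
      fix x assume x: "x \<in> {a..t}"
      then have "norm (A x (v n x)) \<le> norm (A x) * norm (v n x)" by (intro norm_blinfun)
      also have "\<dots> \<le> M * ?p n x"
        using x Suc.prems by (intro mult_mono M Suc.IH M0) auto
      finally show "norm (A x (v n x)) \<le> M * ?p n x" .
    qed (use p in blast)
    then show ?case using integral_unique[OF p] by simp
  qed (simp add: v0)
  let ?m = "\<lambda>n. norm c * (M * (b - a)) ^ n / fact n"
  have bound': "norm (v n t) \<le> ?m n" if "t \<in> {a..b}" for n t
    using that M0 by (intro order_trans[OF bound]) (auto intro!: mult_left_mono divide_right_mono power_mono)
  have summ: "summable ?m"
    using summable_mult[OF summable_exp[of "M * (b - a)"], of "norm c"] by (simp add: divide_inverse mult_ac)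
  define u where "u t = (\<Sum>n. v n t)" for t
  have ul: "uniform_limit {a..b} (\<lambda>n t. \<Sum>i<n. v i t) u sequentially"
    unfolding u_def by (rule Weierstrass_m_test[OF bound' summ])
  define D where "D n t = (case n of 0 \<Rightarrow> 0 | Suc k \<Rightarrow> A t (v k t))" for n t
  have D0: "D 0 t = 0" and DS: "D (Suc k) t = A t (v k t)" for t k
    by (simp_all add: D_def)
  have dv: "(v n has_vector_derivative D n t) (at t within {a..b})" if "t \<in> {a..b}" for n t
    using vd[OF that] by (cases n) (simp_all add: D0 DS v0)
  \<comment> \<open>The derivative series is \<open>A t\<close> applied to the series itself,
    shifted by one index; uniform convergence of the derivatives is thus inherited from that of the
    values.\<close>
  have sumD: "(\<Sum>i<Suc n. D i t) = A t (\<Sum>i<n. v i t)" for n t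
    by (simp add: sum.lessThan_Suc_shift D0 DS blinfun.sum_right del: sum.lessThan_Suc)
  have "\<exists>g. \<forall>t\<in>{a..b}. (\<lambda>n. v n t) sums (g t) \<and>
      (g has_derivative (\<lambda>h. h *\<^sub>R A t (u t))) (at t within {a..b})"
  proof (rule has_derivative_series)
    show "convex {a..b}" by simp
    show "(v n has_derivative (\<lambda>h. h *\<^sub>R D n t)) (at t within {a..b})" if "t \<in> {a..b}" for n t
      using dv[OF that] by (simp add: has_vector_derivative_def)
    show "a \<in> {a..b}" using ab by simp
    show "(\<lambda>n. v n a) sums u a"
      unfolding u_def using ab
      by (intro summable_sums summable_comparison_test[OF _ summ]) (auto intro!: exI[of _ 0] bound')
    \<comment> \<open>The tolerance used is \<open>e / (M + 1)\<close>, since \<open>M\<close> may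
      be 0.\<close>
    fix e :: real assume e: "e > 0"
    have "\<forall>\<^sub>F n in sequentially. \<forall>t\<in>{a..b}. dist (\<Sum>i<n. v i t) (u t) < e / (M + 1)"
      using ul e M0 by (intro uniform_limitD) auto
    then have "\<forall>\<^sub>F n in sequentially. \<forall>t\<in>{a..b}. \<forall>h.
        norm ((\<Sum>i<Suc n. h *\<^sub>R D i t) - h *\<^sub>R A t (u t)) \<le> e * norm h"
    proof eventually_elim
      case (elim n)
      show ?case
      proof (intro ballI allI)
        fix t h assume t: "t \<in> {a..b}"
        have "norm ((\<Sum>i<Suc n. h *\<^sub>R D i t) - h *\<^sub>R A t (u t)) = \<bar>h\<bar> * norm (A t ((\<Sum>i<n. v i t) - u t))"
          by (simp only: scaleR_right.sum[symmetric] sumD scaleR_diff_right[symmetric] blinfun.diff_right norm_scaleR)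
        also have "\<dots> \<le> \<bar>h\<bar> * (norm (A t) * norm ((\<Sum>i<n. v i t) - u t))"
          by (intro mult_left_mono norm_blinfun) auto
        also have "\<dots> \<le> \<bar>h\<bar> * ((M + 1) * (e / (M + 1)))"
          using elim t M[OF t] M0 by (intro mult_left_mono mult_mono) (auto simp: dist_norm less_imp_le)
        finally show "norm ((\<Sum>i<Suc n. h *\<^sub>R D i t) - h *\<^sub>R A t (u t)) \<le> e * norm h"
          using M0 by (simp add: mult.commute)
      qed
    qed
    then show "\<forall>\<^sub>F n in sequentially. \<forall>t\<in>{a..b}. \<forall>h.
        norm ((\<Sum>i<n. h *\<^sub>R D i t) - h *\<^sub>R A t (u t)) \<le> e * norm h"
      by (subst (asm) eventually_sequentially_Suc)
  qed
  then obtain g where g: "\<And>t. t \<in> {a..b} \<Longrightarrow> (\<lambda>n. v n t) sums (g t)"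
    "\<And>t. t \<in> {a..b} \<Longrightarrow> (g has_vector_derivative A t (u t)) (at t within {a..b})"
    unfolding has_vector_derivative_def by blast
  have gu: "g t = u t" if "t \<in> {a..b}" for t
    using g(1)[OF that] by (simp add: u_def sums_iff)
  have "v (Suc n) a = 0" for n by (simp add: vS)
  then have "(\<lambda>n. v n a) sums c"
    using sums_Suc[of "\<lambda>n. v n a" 0] by (simp add: v0)
  with g(1)[of a] ab have "g a = c" by (auto intro: sums_unique2)
  then show ?thesis using g(2) gu by auto
qed

text \<open>The map from the value at \<open>a\<close> to the value at \<open>s\<close> is linear
  and, by uniqueness, injective. In finite dimension it is onto, so some initial value at
  \<open>a\<close> reaches \<open>c\<close> at \<open>s\<close> and nothing has to be solved
  backwards.\<close>

lemma linear_ode_exists_Icc: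
  fixes A :: "real \<Rightarrow> 'a::euclidean_space \<Rightarrow>\<^sub>L 'a"
  assumes A: "continuous_on {a..b} A" and s: "s \<in> {a..b}"
  shows "\<exists>u. u s = c \<and> (\<forall>t\<in>{a..b}. (u has_vector_derivative A t (u t)) (at t within {a..b}))"
proof -
  have ab: "a \<le> b" using s by auto
  have "\<exists>w. \<forall>c. w c a = c \<and>
      (\<forall>t\<in>{a..b}. (w c has_vector_derivative A t (w c t)) (at t within {a..b}))"
    by (intro choice allI linear_ode_exists_left[OF A ab])
  then obtain w where w0: "\<And>c. w c a = c"
    and w: "\<And>c t. t \<in> {a..b} \<Longrightarrow> (w c has_vector_derivative A t (w c t)) (at t within {a..b})"
    by blast
  have eq: "w (x + r *\<^sub>R y) s = w x s + r *\<^sub>R w y s" for x y r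
  proof -
    have "w (x + r *\<^sub>R y) s - (w x s + r *\<^sub>R w y s) = 0"
    proof (rule linear_ode_unique[OF A, of "\<lambda>t. w (x + r *\<^sub>R y) t - (w x t + r *\<^sub>R w y t)" a])
      fix t assume t: "t \<in> {a..b}"
      show "((\<lambda>t. w (x + r *\<^sub>R y) t - (w x t + r *\<^sub>R w y t)) has_vector_derivative
          A t (w (x + r *\<^sub>R y) t - (w x t + r *\<^sub>R w y t))) (at t within {a..b})"
        using w[OF t] by (auto intro!: derivative_eq_intros simp: blinfun.bilinear_simps)
    qed (use ab s w0 in auto)
    then show ?thesis by simp
  qed
  have "linear (\<lambda>c. w c s)"
  proof (rule linearI)
    fix x y :: 'a and r :: real
    show "w (x + y) s = w x s + w y s" using eq[of x 1 y] by simp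
    have "w 0 s = 0" using eq[of 0 1 0] by simp
    then show "w (r *\<^sub>R y) s = r *\<^sub>R w y s" using eq[of 0 r y] by simp
  qed
  moreover have "inj (\<lambda>c. w c s)"
    unfolding linear_injective_0[OF \<open>linear (\<lambda>c. w c s)\<close>]
  proof (intro allI impI)
    fix c assume "w c s = 0"
    then have "w c a = 0" using linear_ode_unique[OF A w s, of c a] ab by auto
    then show "c = 0" using w0 by simp
  qed
  ultimately have "surj (\<lambda>c. w c s)" by (intro linear_injective_imp_surjective) auto
  then obtain c' where "w c' s = c" by (metis surjD)
  then show ?thesis using w by blast
qed

lemma linear_ode_exists:
  fixes A :: "real \<Rightarrow> 'a::euclidean_space \<Rightarrow>\<^sub>L 'a"
  assumes I: "is_interval I" and A: "continuous_on I A" and s: "s \<in> I"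
  shows "\<exists>u. u s = c \<and> (\<forall>t\<in>I. (u has_vector_derivative A t (u t)) (at t within I))"
proof -
  have ex: "\<exists>w. {a..b} \<subseteq> I \<and> s \<in> {a..b} \<longrightarrow>
      w s = c \<and> (\<forall>t\<in>{a..b}. (w has_vector_derivative A t (w t)) (at t within {a..b}))" for a b
  proof (cases "{a..b} \<subseteq> I \<and> s \<in> {a..b}")
    case True
    then show ?thesis
      using linear_ode_exists_Icc[OF continuous_on_subset[OF A], of a b s c] by simp
  qed auto
  define w where "w a b = (SOME w. {a..b} \<subseteq> I \<and> s \<in> {a..b} \<longrightarrow>
      w s = c \<and> (\<forall>t\<in>{a..b}. (w has_vector_derivative A t (w t)) (at t within {a..b})))" for a b
  have ws: "w a b s = c"
    and w: "\<And>t. t \<in> {a..b} \<Longrightarrow> (w a b has_vector_derivative A t (w a b t)) (at t within {a..b})"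
    if "{a..b} \<subseteq> I" "s \<in> {a..b}" for a b
    using someI_ex[OF ex[of a b]] that unfolding w_def[symmetric] by blast+
  \<comment> \<open>The value at \<open>t\<close> comes from the solution chosen on the segment
    between \<open>s\<close> and \<open>t\<close>; uniqueness then identifies \<open>u\<close> with
    every chosen local solution.\<close>
  define u where "u t = w (min s t) (max s t) t" for t
  have uw: "u t = w a b t" if ab: "{a..b} \<subseteq> I" "s \<in> {a..b}" "t \<in> {a..b}" for a b t
  proof -
    let ?K = "{min s t..max s t}"
    have K: "?K \<subseteq> {a..b}" using ab by auto
    have KI: "?K \<subseteq> I" using K ab by blast
    have sK: "s \<in> ?K" by auto
    have "u t - w a b t = 0" unfolding u_def
    proof (rule linear_ode_unique[of "min s t" "max s t" A "\<lambda>x. w (min s t) (max s t) x - w a b x" s])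
      show "continuous_on ?K A" using A KI continuous_on_subset by blast
      fix x assume x: "x \<in> ?K"
      have "x \<in> {a..b}" using x K by blast
      then have "(w a b has_vector_derivative A x (w a b x)) (at x within ?K)"
        using w[OF ab(1,2)] K has_vector_derivative_within_subset by blast
      with w[OF KI sK x] show "((\<lambda>x. w (min s t) (max s t) x - w a b x) has_vector_derivative
          A x (w (min s t) (max s t) x - w a b x)) (at x within ?K)"
        by (auto intro!: derivative_eq_intros simp: blinfun.bilinear_simps)
    qed (use ws[OF KI sK] ws[OF ab(1,2)] in auto)
    then show ?thesis by simp
  qed
  show ?thesis
  proof (intro exI[of _ u] conjI ballI)
    show "u s = c" using ws[of s s] s by (simp add: u_def)
    fix t assume "t \<in> I"
    then obtain a b where ab: "{a..b} \<subseteq> I" "t \<in> {a..b}" "s \<in> {a..b}" "at t within {a..b} = at t within I"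
      using at_within_interval_compact[OF I _ s] by blast
    have "(w a b has_vector_derivative A t (w a b t)) (at t within I)"
      using w[OF ab(1,3,2)] ab(4) by simp
    then have "(w a b has_vector_derivative A t (u t)) (at t within {a..b})"
      using uw[OF ab(1,3,2)] ab by simp
    then have "(u has_vector_derivative A t (u t)) (at t within {a..b})"
      by (rule has_vector_derivative_transform_within[OF _ zero_less_one ab(2)])
        (use uw ab in auto)
    then show "(u has_vector_derivative A t (u t)) (at t within I)" using ab by simp
  qed
qed

subsection \<open>Linear algebra\<close>

text \<open>For counting modulo \<open>N\<close>: a basis of the orthogonal complement of
  \<open>N\<close> in \<open>A\<close> serves as a set of unknowns (independent, orthogonal to
  \<open>N\<close>) and as a set of test vectors (together with \<open>N\<close> it spans
  \<open>A\<close>).\<close>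

lemma orthogonal_complement_basis:
  fixes A N :: "'a::euclidean_space set"
  assumes A: "subspace A" and N: "subspace N" and NA: "N \<subseteq> A"
  obtains B where "finite B" "independent B" "B \<subseteq> A" "card B + dim N = dim A"
    "\<And>x y. x \<in> N \<Longrightarrow> y \<in> span B \<Longrightarrow> x \<bullet> y = 0"
    "\<And>v. v \<in> A \<Longrightarrow> \<exists>x\<in>N. \<exists>y\<in>span B. v = x + y"
proof -
  let ?C = "{y \<in> A. \<forall>x\<in>N. orthogonal x y}"
  have C: "subspace ?C"
    using A by (auto simp: subspace_def orthogonal_def inner_right_distrib)
  obtain B where B: "B \<subseteq> ?C" "independent B" "?C \<subseteq> span B" "card B = dim ?C"
    using basis_exists by blast
  have sB: "span B = ?C" using B(1,3) C by (simp add: span_subspace)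
  show thesis
  proof (rule that)
    show "finite B" using B(2) independent_imp_finite by blast
    show "card B + dim N = dim A"
      using dim_subspace_orthogonal_to_vectors[OF N A NA] B(4) by simp
    show "x \<bullet> y = 0" if "x \<in> N" "y \<in> span B" for x y
      using that sB by (auto simp: orthogonal_def)
    fix v assume v: "v \<in> A"
    obtain y z where yz: "y \<in> span N" "\<And>w. w \<in> span N \<Longrightarrow> orthogonal z w" "v = y + z"
      using orthogonal_subspace_decomp_exists[of N v] by metis
    have y: "y \<in> N" using yz(1) N by (simp add: span_eq_iff[THEN iffD2])
    have "z = v - y" using yz(3) by simp
    then have "z \<in> A" using A v y NA by (auto intro: subspace_diff)
    then have "z \<in> span B"
      using yz(2) by (auto simp: sB orthogonal_commute span_base)
    then show "\<exists>x\<in>N. \<exists>y\<in>span B. v = x + y" using y yz(3) by blast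
  qed (use B in auto)
qed

text \<open>Gaussian elimination: an equation with a nonzero coefficient at \<open>r\<close>
  determines that unknown, and substituting it leaves one equation and one unknown fewer.\<close>

lemma homogeneous_system_nontrivial_solution:
  fixes a :: "'t \<Rightarrow> 's \<Rightarrow> 'f::field"
  assumes "finite T" "finite S" "card T < card S"
  shows "\<exists>c. (\<exists>s\<in>S. c s \<noteq> 0) \<and> (\<forall>i\<in>T. (\<Sum>s\<in>S. a i s * c s) = 0)"
  using assms
proof (induction T arbitrary: S a rule: finite_induct)
  case empty
  then obtain s where "s \<in> S" by fastforce
  then show ?case by (intro exI[of _ "\<lambda>_. 1"]) auto
next
  case (insert k T)
  show ?case
  proof (cases "\<forall>s\<in>S. a k s = 0")
    case True
    then show ?thesis using insert.IH[OF insert.prems(1), of a] insert by auto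
  next
    case False
    then obtain r where r: "r \<in> S" "a k r \<noteq> 0" by blast
    define S' where "S' = S - {r}"
    have S: "S = insert r S'" "r \<notin> S'" "finite S'" using r insert.prems by (auto simp: S'_def)
    have "card T < card S'" using insert S by simp
    from insert.IH[OF S(3) this, of "\<lambda>i s. a i s - a i r * a k s / a k r"]
    obtain c s where c: "s \<in> S'" "c s \<noteq> 0"
      "\<And>i. i \<in> T \<Longrightarrow> (\<Sum>s\<in>S'. (a i s - a i r * a k s / a k r) * c s) = 0" by blast
    define z where "z = - (\<Sum>s\<in>S'. a k s * c s) / a k r"
    define c' where "c' = c(r := z)"
    have sum: "(\<Sum>s\<in>S. a i s * c' s) = a i r * z + (\<Sum>s\<in>S'. a i s * c s)" for i
      using S by (auto simp: c'_def intro!: sum.cong)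
    have "(\<Sum>s\<in>S. a i s * c' s) = 0" if "i \<in> insert k T" for i
    proof (cases "i = k")
      case True
      then show ?thesis using r by (simp add: sum z_def)
    next
      case False
      have "(\<Sum>s\<in>S'. (a i s - a i r * a k s / a k r) * c s) =
          (\<Sum>s\<in>S'. a i s * c s) + a i r * z"
        by (simp add: z_def algebra_simps sum_subtractf sum_distrib_left sum_divide_distrib)
      then show ?thesis using c(3)[of i] that False sum[of i] by (simp add: add.commute)
    qed
    moreover have "c' s \<noteq> 0" using c S by (auto simp: c'_def)
    ultimately show ?thesis using c S by blast
  qed
qed

text \<open>Linearity and a finite basis turn pointwise limits into a bound uniform in
  \<open>p\<close>. Uniformity matters because it will be applied to interpolating fields that vary
  with \<open>t\<close>.\<close>

lemma linear_family_eventually_small: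
  fixes F :: "'b \<Rightarrow> 'a::euclidean_space \<Rightarrow> 'c::real_normed_vector"
  assumes lin: "\<forall>\<^sub>F t in X. linear (F t)" and lim: "\<And>b. b \<in> Basis \<Longrightarrow> ((\<lambda>t. F t b) \<longlongrightarrow> 0) X"
    and "\<epsilon> > 0"
  shows "\<forall>\<^sub>F t in X. \<forall>p. norm (F t p) \<le> \<epsilon> * norm p"
proof -
  have "((\<lambda>t. \<Sum>b\<in>Basis. norm (F t b)) \<longlongrightarrow> (\<Sum>b\<in>(Basis::'a set). 0)) X"
    by (intro tendsto_sum tendsto_norm_zero lim)
  then have "\<forall>\<^sub>F t in X. (\<Sum>b\<in>Basis. norm (F t b)) < \<epsilon>"
    using order_tendstoD(2)[of _ 0] \<open>\<epsilon> > 0\<close> by simp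
  with lin show ?thesis
  proof eventually_elim
    case (elim t)
    interpret linear "F t" by (rule elim)
    show ?case
    proof
      fix p
      have "F t p = (\<Sum>b\<in>Basis. (p \<bullet> b) *\<^sub>R F t b)"
        by (subst euclidean_representation[of p, symmetric]) (simp only: sum scale)
      also have "norm \<dots> \<le> (\<Sum>b\<in>Basis. norm p * norm (F t b))"
        by (intro sum_norm_le) (simp add: Basis_le_norm mult_right_mono)
      also have "\<dots> \<le> \<epsilon> * norm p"
        using mult_right_mono[OF less_imp_le[OF elim(2)] norm_ge_zero[of p]]
        by (simp add: sum_distrib_left[symmetric] mult.commute)
      finally show "norm (F t p) \<le> \<epsilon> * norm p" .
    qed
  qed
qed

subsection \<open>Lagrangian subspaces of a symplectic flow\<close>

text \<open>Jacobi fields are parametrized by Cauchy data \<open>p\<close>; \<open>e t p\<close> and \<open>d t p\<close> are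
  the value and the derivative at \<open>t\<close>.\<close>

locale symplectic_flow =
  fixes I :: "real set" and e d :: "real \<Rightarrow> 'v::euclidean_space \<times> 'v \<Rightarrow> 'v"
    and om :: "'v \<times> 'v \<Rightarrow> 'v \<times> 'v \<Rightarrow> real"
  assumes linear_e: "t \<in> I \<Longrightarrow> linear (e t)" and linear_d: "t \<in> I \<Longrightarrow> linear (d t)"
    and deriv_e: "t \<in> I \<Longrightarrow> ((\<lambda>s. e s p) has_vector_derivative d t p) (at t within I)"
    and data_inj: "t \<in> I \<Longrightarrow> e t p = 0 \<Longrightarrow> d t p = 0 \<Longrightarrow> p = 0"
    and om: "t \<in> I \<Longrightarrow> om p q = e t p \<bullet> d t q - d t p \<bullet> e t q"
begin

definition "lag A \<longleftrightarrow> subspace A \<and> A = {p. \<forall>q\<in>A. om p q = 0}"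

definition "vanishing A t = {p \<in> A. e t p = 0}"

lemma lag_subspace: "lag A \<Longrightarrow> subspace A"
  by (simp add: lag_def)

lemma lag_om: "lag A \<Longrightarrow> p \<in> A \<Longrightarrow> q \<in> A \<Longrightarrow> om p q = 0"
  unfolding lag_def by blast

lemma lag_sym: "lag A \<Longrightarrow> p \<in> A \<Longrightarrow> q \<in> A \<Longrightarrow> t \<in> I \<Longrightarrow> e t p \<bullet> d t q = d t p \<bullet> e t q"
  using lag_om[of A p q] om[of t p q] by simp

lemma subspace_vanishing: "subspace A \<Longrightarrow> t \<in> I \<Longrightarrow> subspace (vanishing A t)"
  using linear_e[of t] unfolding vanishing_def subspace_def
  by (auto simp: linear_0 linear_add linear_scale)

text \<open>\<open>om p q\<close> is the Euclidean inner product of \<open>U p\<close> and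
  \<open>W q\<close>, so a Lagrangian \<open>A\<close> has its image under \<open>U\<close> equal to
  the orthogonal complement of its image under \<open>W\<close>. Both images have the dimension of
  \<open>A\<close>.\<close>

lemma dim_lag:
  assumes "lag A" "t \<in> I"
  shows "dim A = DIM('v)"
proof -
  define U where "U p = (e t p, d t p)" for p
  define W where "W p = (d t p, - e t p)" for p
  interpret E: linear "e t" by (rule linear_e) fact
  interpret D: linear "d t" by (rule linear_d) fact
  have U: "linear U" "inj_on U (span A)"
  proof -
    show "linear U" by (rule linearI) (simp_all add: U_def E.add D.add E.scale D.scale)
    then have "inj U"
      using data_inj[OF assms(2)] by (auto simp: linear_injective_0 U_def zero_prod_def)
    then show "inj_on U (span A)" by (rule inj_on_subset) simp
  qed
  have W: "linear W" "inj_on W (span A)"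
  proof -
    show "linear W" by (rule linearI) (simp_all add: W_def E.add D.add E.scale D.scale)
    then have "inj W"
      using data_inj[OF assms(2)] by (auto simp: linear_injective_0 W_def zero_prod_def)
    then show "inj_on W (span A)" by (rule inj_on_subset) simp
  qed
  have surj: "surj U"
    using U(1) data_inj[OF assms(2)]
    by (intro linear_injective_imp_surjective) (auto simp: linear_injective_0 U_def zero_prod_def)
  have "U ` A = {y \<in> UNIV. \<forall>x\<in>W ` A. orthogonal x y}"
  proof (intro set_eqI iffI)
    fix y assume "y \<in> U ` A"
    then show "y \<in> {y \<in> UNIV. \<forall>x\<in>W ` A. orthogonal x y}"
      using lag_om[OF assms(1)] om[OF assms(2)]
      by (fastforce simp: orthogonal_def U_def W_def inner_prod_def inner_commute)
  next
    fix y assume y: "y \<in> {y \<in> UNIV. \<forall>x\<in>W ` A. orthogonal x y}"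
    obtain p where p: "y = U p" using surj by blast
    have "om p q = 0" if "q \<in> A" for q
      using y that om[OF assms(2), of p q]
      by (force simp: p orthogonal_def U_def W_def inner_prod_def inner_commute)
    then have "p \<in> A" using assms(1) unfolding lag_def by blast
    then show "y \<in> U ` A" using p by blast
  qed
  then have "dim (U ` A) + dim (W ` A) = dim (UNIV :: ('v \<times> 'v) set)"
    using dim_subspace_orthogonal_to_vectors[of "W ` A" UNIV] W(1) lag_subspace[OF assms(1)]
    by (simp add: linear_subspace_image)
  then show ?thesis
    using dim_image_eq[OF U] dim_image_eq[OF W] by simp
qed

text \<open>Values of \<open>A\<close> are orthogonal to the derivatives of
  \<open>vanishing A t\<close> by isotropy. These derivatives form a space of the same dimension as
  \<open>vanishing A t\<close>, so by rank-nullity the values fill the whole orthogonal complement.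
  Membership thus becomes finitely many linear equations.\<close>

lemma mem_values_lag:
  assumes "lag A" "t \<in> I" and v: "\<And>p. p \<in> vanishing A t \<Longrightarrow> v \<bullet> d t p = 0"
  shows "v \<in> e t ` A"
proof -
  let ?N = "vanishing A t"
  interpret E: linear "e t" by (rule linear_e) fact
  interpret D: linear "d t" by (rule linear_d) fact
  have A: "subspace A" using assms(1) by (rule lag_subspace)
  have N: "subspace ?N" "?N \<subseteq> A"
    using subspace_vanishing[OF A assms(2)] by (auto simp: vanishing_def)
  have sN: "span ?N = ?N" using N(1) span_eq_iff by blast
  have "inj_on (d t) (span ?N)"
    unfolding sN using data_inj[OF assms(2)] linear_injective_on_subspace_0[OF D.linear_axioms N(1)]
    by (auto simp: vanishing_def)
  then have dimD: "dim (d t ` ?N) = dim ?N" by (rule dim_image_eq[OF D.linear_axioms])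
  let ?O = "{y \<in> UNIV. \<forall>x\<in>d t ` ?N. orthogonal x y}"
  have "dim ?O + dim (d t ` ?N) = dim (UNIV :: 'v set)"
    using N D.linear_axioms by (intro dim_subspace_orthogonal_to_vectors) (auto simp: linear_subspace_image)
  then have dimO: "dim ?O + dim ?N = DIM('v)" using dimD by simp
  obtain B where B: "finite B" "independent B" "B \<subseteq> A" "card B + dim ?N = dim A"
    "\<And>x y. x \<in> ?N \<Longrightarrow> y \<in> span B \<Longrightarrow> x \<bullet> y = 0"
    using orthogonal_complement_basis[OF A N] by metis
  have BA: "span B \<subseteq> A" using B(3) A by (simp add: span_minimal)
  have "x = 0" if "x \<in> span B" "e t x = 0" for x
    using B(5)[of x x] that BA by (auto simp: vanishing_def)
  then have "inj_on (e t) (span B)"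
    using linear_injective_on_subspace_0[OF E.linear_axioms subspace_span] by blast
  then have "dim (e t ` span B) = card B"
    using dim_image_eq[OF E.linear_axioms, of "span B"] B(2) by (simp add: dim_eq_card_independent span_span)
  moreover have "dim (e t ` span B) \<le> dim (e t ` A)" using BA by (intro dim_subset) auto
  ultimately have "dim ?O \<le> dim (e t ` A)"
    using dimO B(4) dim_lag[OF assms(1,2)] by simp
  moreover have "e t ` A \<subseteq> ?O"
    using lag_sym[OF assms(1) _ _ assms(2)] by (fastforce simp: orthogonal_def vanishing_def)
  ultimately have "e t ` A = ?O"
    using A E.linear_axioms subspace_orthogonal_to_vectors[of "d t ` ?N"]
    by (intro subspace_dim_equal) (auto simp: linear_subspace_image)
  then show ?thesis using v by (auto simp: orthogonal_def inner_commute)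
qed

lemma values_lag_UNIV:
  assumes "lag A" "t \<in> I" "vanishing A t \<subseteq> {0}"
  shows "e t ` A = UNIV"
proof -
  have "d t p = 0" if "p \<in> vanishing A t" for p
    using that assms(3) linear_0[OF linear_d[OF assms(2)]] by auto
  then show ?thesis using mem_values_lag[OF assms(1,2)] by auto
qed

section \<open>Evaluation near a point: uniform remainder and lower bounds\<close>

lemma eval_remainder:
  assumes "t0 \<in> I" "\<epsilon> > 0"
  shows "\<forall>\<^sub>F t in at t0 within I.
    \<forall>p. norm (e t p - e t0 p - (t - t0) *\<^sub>R d t0 p) \<le> \<epsilon> * \<bar>t - t0\<bar> * norm p"
proof -
  define F where "F t p = (1 / norm (t - t0)) *\<^sub>R (e t p - (e t0 p + (t - t0) *\<^sub>R d t0 p))" for t p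
  have ev: "\<forall>\<^sub>F t in at t0 within I. t \<in> I \<and> t \<noteq> t0"
    by (simp add: eventually_at_filter)
  have "\<forall>\<^sub>F t in at t0 within I. \<forall>p. norm (F t p) \<le> \<epsilon> * norm p"
  proof (rule linear_family_eventually_small)
    show "\<forall>\<^sub>F t in at t0 within I. linear (F t)"
      using ev
    proof eventually_elim
      case (elim t)
      interpret E: linear "e t" using elim by (simp add: linear_e)
      interpret E0: linear "e t0" using assms by (simp add: linear_e)
      interpret D0: linear "d t0" using assms by (simp add: linear_d)
      show ?case
        by (rule linearI) (simp_all add: F_def E.add E0.add D0.add E.scale E0.scale D0.scale algebra_simps)
    qed
    show "((\<lambda>t. F t b) \<longlongrightarrow> 0) (at t0 within I)" for b
      using deriv_e[OF assms(1), of b] unfolding F_def has_vector_derivative_def has_derivative_within by simp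
  qed (fact assms)
  with ev show ?thesis
  proof eventually_elim
    case (elim t)
    then show ?case
      by (auto simp: F_def divide_simps diff_diff_eq mult_ac)
  qed
qed

text \<open>An injective evaluation is bounded below on the finite-dimensional \<open>A\<close>, and
  half of the bound survives nearby. The 1 in \<open>1 + L\<close> is the rate chosen in
  \<open>eval_remainder\<close>.\<close>

lemma eventually_bounded_below_nonfocal:
  assumes "t0 \<in> I" "subspace A" "vanishing A t0 \<subseteq> {0}"
  obtains c where "c > 0" "\<forall>\<^sub>F t in at t0 within I. \<forall>p\<in>A. c * norm p \<le> norm (e t p)"
proof -
  have D: "bounded_linear (d t0)" using linear_d[OF assms(1)] linear_conv_bounded_linear by blast
  obtain c where c: "c > 0" "\<And>p. p \<in> A \<Longrightarrow> c * norm p \<le> norm (e t0 p)"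
    using injective_imp_isometric[of A "e t0"] assms closed_subspace[of A] linear_e[OF assms(1)]
    by (auto simp: vanishing_def linear_conv_bounded_linear mult.commute)
  obtain L where L: "L > 0" "\<And>p. norm (d t0 p) \<le> norm p * L"
    using bounded_linear.pos_bounded[OF D] by blast
  have "\<forall>\<^sub>F t in at t0 within I. \<bar>t - t0\<bar> < c / (2 * (1 + L))"
    using c L by (auto simp: eventually_at dist_real_def intro!: exI[of _ "c / (2 * (1 + L))"])
  with eval_remainder[OF assms(1) zero_less_one]
  have "\<forall>\<^sub>F t in at t0 within I. \<forall>p\<in>A. (c / 2) * norm p \<le> norm (e t p)"
  proof eventually_elim
    case (elim t)
    show ?case
    proof
      fix p assume p: "p \<in> A"
      have "norm (e t0 p) \<le> norm (e t p) + norm (e t p - e t0 p - (t - t0) *\<^sub>R d t0 p) + norm ((t - t0) *\<^sub>R d t0 p)"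
        using norm_triangle_ineq4[of "e t p" "(e t p - e t0 p - (t - t0) *\<^sub>R d t0 p) + (t - t0) *\<^sub>R d t0 p"]
          norm_triangle_ineq[of "e t p - e t0 p - (t - t0) *\<^sub>R d t0 p" "(t - t0) *\<^sub>R d t0 p"] by simp
      also have "\<dots> \<le> norm (e t p) + \<bar>t - t0\<bar> * norm p + \<bar>t - t0\<bar> * (norm p * L)"
        using elim(1)[rule_format, of p] L(2)[of p]
        by (intro add_mono) (simp_all add: mult_left_mono)
      also have "\<dots> = norm (e t p) + (\<bar>t - t0\<bar> * (1 + L)) * norm p" by (simp add: algebra_simps)
      also have "\<dots> \<le> norm (e t p) + (c / 2) * norm p"
        using elim(2) L by (intro add_left_mono mult_right_mono) (auto simp: field_simps)
      finally show "(c / 2) * norm p \<le> norm (e t p)" using c(2)[OF p] by simp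
    qed
  qed
  then show thesis using that[of "c / 2"] c by simp
qed

text \<open>Write p = P + Q with P vanishing at \<open>t0\<close> and Q orthogonal to all such
  fields. Up to small errors \<open>e t p\<close> is (t - t0) \<open>d t0 P\<close> +
  \<open>e t0 Q\<close>, with orthogonal summands because \<open>A\<close> is Lagrangian. So
  \<open>e t p\<close> controls Q uniformly; it controls P only after a factor |t - t0|, but P does
  not contribute at \<open>t0\<close>.\<close>

lemma eventually_bounded_below_focal:
  assumes "t0 \<in> I" "lag A"
  obtains C where "\<forall>\<^sub>F t in at t0 within I. \<forall>p\<in>A. norm (e t0 p) \<le> C * norm (e t p)"
proof -
  let ?N = "vanishing A t0"
  interpret E0: linear "e t0" using assms by (simp add: linear_e)
  interpret D0: linear "d t0" using assms by (simp add: linear_d)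
  have E: "bounded_linear (e t0)" and D: "bounded_linear (d t0)"
    using linear_conv_bounded_linear E0.linear_axioms D0.linear_axioms by blast+
  have A: "subspace A" using assms(2) by (rule lag_subspace)
  have N: "subspace ?N" "?N \<subseteq> A"
    using subspace_vanishing[OF A assms(1)] by (auto simp: vanishing_def)
  obtain B where B: "B \<subseteq> A" "\<And>x y. x \<in> ?N \<Longrightarrow> y \<in> span B \<Longrightarrow> x \<bullet> y = 0"
    "\<And>v. v \<in> A \<Longrightarrow> \<exists>x\<in>?N. \<exists>y\<in>span B. v = x + y"
    using orthogonal_complement_basis[OF A N] by metis
  have BA: "span B \<subseteq> A" using B(1) A by (simp add: span_minimal)
  have inj: "x = 0" if "x \<in> span B" "e t0 x = 0" for x
    using B(2)[of x x] that BA by (auto simp: vanishing_def)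
  obtain c1 where c1: "c1 > 0" "\<And>p. p \<in> ?N \<Longrightarrow> c1 * norm p \<le> norm (d t0 p)"
    using injective_imp_isometric[of ?N "d t0"] N closed_subspace[of ?N] D data_inj[OF assms(1)]
    by (auto simp: vanishing_def mult.commute)
  obtain c2 where c2: "c2 > 0" "\<And>p. p \<in> span B \<Longrightarrow> c2 * norm p \<le> norm (e t0 p)"
    using injective_imp_isometric[of "span B" "e t0"] closed_subspace[of "span B"] E inj
    by (auto simp: mult.commute)
  define c where "c = min c1 c2"
  have le: "c * norm (p :: 'v \<times> 'v) \<le> c1 * norm p" "c * norm p \<le> c2 * norm p" for p
    by (simp_all add: c_def mult_right_mono)
  have c: "c > 0" using c1 c2 by (simp add: c_def)
  have cd: "c * norm p \<le> norm (d t0 p)" if "p \<in> ?N" for p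
    using le(1)[of p] c1(2)[OF that] by (rule order_trans)
  have ce: "c * norm p \<le> norm (e t0 p)" if "p \<in> span B" for p
    using le(2)[of p] c2(2)[OF that] by (rule order_trans)
  obtain L where L: "L > 0" "\<And>p. norm (d t0 p) \<le> norm p * L"
    using bounded_linear.pos_bounded[OF D] by blast
  obtain K where K: "K > 0" "\<And>p. norm (e t0 p) \<le> norm p * K"
    using bounded_linear.pos_bounded[OF E] by blast
  \<comment> \<open>Chosen so that |t - t0| (c / 4 + L) is at most c / 4, which absorbs both errors
    caused by \<open>Q\<close>: its remainder and its first-order term.\<close>
  define \<delta> where "\<delta> = (c / 4) / (c / 4 + L)"
  have c4: "c / 4 > 0" using c by simp
  have \<delta>: "\<delta> > 0" using c4 L by (simp add: \<delta>_def)
  have "\<forall>\<^sub>F t in at t0 within I. \<bar>t - t0\<bar> < \<delta>"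
    using \<delta> by (auto simp: eventually_at dist_real_def)
  moreover have "\<forall>\<^sub>F t in at t0 within I. t \<in> I"
    by (simp add: eventually_at_filter)
  ultimately have "\<forall>\<^sub>F t in at t0 within I. \<forall>p\<in>A. norm (e t0 p) \<le> (4 * K / c) * norm (e t p)"
    using eval_remainder[OF assms(1) c4]
  proof eventually_elim
    case (elim t)
    interpret Et: linear "e t" using elim(2) by (rule linear_e)
    show ?case
    proof
      fix p assume "p \<in> A"
      then obtain P Q where PQ: "P \<in> ?N" "Q \<in> span B" "p = P + Q" using B(3) by blast
      let ?\<tau> = "t - t0" and ?r = "\<lambda>p. e t p - e t0 p - (t - t0) *\<^sub>R d t0 p"
      have t0: "e t0 P = 0" using PQ(1) by (simp add: vanishing_def)
      have small: "\<bar>?\<tau>\<bar> * (c / 4 + L) \<le> c / 4"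
        using elim(1) c4 L by (simp add: \<delta>_def field_simps)
      let ?X = "?\<tau> *\<^sub>R d t0 P + e t0 Q"
      have "d t0 P \<bullet> e t0 Q = 0"
        using lag_sym[OF assms(2) _ _ assms(1), of P Q] PQ N BA t0 by auto
      then have sq: "(norm ?X)\<^sup>2 = (\<bar>?\<tau>\<bar> * norm (d t0 P))\<^sup>2 + (norm (e t0 Q))\<^sup>2"
        using norm_add_Pythagorean[of "?\<tau> *\<^sub>R d t0 P" "e t0 Q"] by (simp add: orthogonal_def)
      have X1: "\<bar>?\<tau>\<bar> * norm (d t0 P) \<le> norm ?X"
        by (rule power2_le_imp_le) (simp_all only: sq le_add_same_cancel1 zero_le_power2 norm_ge_zero)
      have X2: "norm (e t0 Q) \<le> norm ?X"
        by (rule power2_le_imp_le) (simp_all only: sq le_add_same_cancel2 zero_le_power2 norm_ge_zero)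
      \<comment> \<open>The mean of the two preceding bounds; errors of rate c / 4 will leave c / 4
        of it.\<close>
      have X: "(c / 2) * (\<bar>?\<tau>\<bar> * norm P + norm Q) \<le> norm ?X"
        using order_trans[OF mult_left_mono[OF cd[OF PQ(1)], of "\<bar>?\<tau>\<bar>"] X1]
          order_trans[OF ce[OF PQ(2)] X2] by (simp add: algebra_simps)
      have p: "e t p = ?X + (?r P + (?r Q + ?\<tau> *\<^sub>R d t0 Q))"
        using t0 by (simp add: PQ(3) Et.add)
      have "norm (?r P + (?r Q + ?\<tau> *\<^sub>R d t0 Q)) \<le> norm (?r P) + (norm (?r Q) + norm (?\<tau> *\<^sub>R d t0 Q))"
        by (meson add_left_mono norm_triangle_ineq order_trans)
      also have "\<dots> \<le> c / 4 * \<bar>?\<tau>\<bar> * norm P + (c / 4 * \<bar>?\<tau>\<bar> * norm Q + \<bar>?\<tau>\<bar> * (norm Q * L))"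
        using elim(3)[rule_format] L(2)[of Q]
        by (intro add_mono) (simp_all add: mult_left_mono)
      also have "\<dots> = c / 4 * (\<bar>?\<tau>\<bar> * norm P) + (\<bar>?\<tau>\<bar> * (c / 4 + L)) * norm Q"
        by (simp add: algebra_simps)
      also have "\<dots> \<le> c / 4 * (\<bar>?\<tau>\<bar> * norm P) + (c / 4) * norm Q"
        by (intro add_left_mono mult_right_mono small) auto
      finally have R: "norm (?r P + (?r Q + ?\<tau> *\<^sub>R d t0 Q)) \<le> c / 4 * (\<bar>?\<tau>\<bar> * norm P + norm Q)"
        by (simp add: algebra_simps)
      have "norm ?X - norm (?r P + (?r Q + ?\<tau> *\<^sub>R d t0 Q)) \<le> norm (?X + (?r P + (?r Q + ?\<tau> *\<^sub>R d t0 Q)))"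
        by (rule norm_diff_ineq)
      then have "c / 4 * (\<bar>?\<tau>\<bar> * norm P + norm Q) \<le> norm (e t p)"
        using X R by (simp add: p)
      then have "c / 4 * norm Q \<le> norm (e t p)"
        by (rule order_trans[rotated]) (use c4 in \<open>auto intro!: mult_left_mono\<close>)
      then have Q: "norm Q \<le> 4 / c * norm (e t p)" using c by (simp add: field_simps)
      have "norm (e t0 p) \<le> norm Q * K" using K(2)[of Q] t0 by (simp add: PQ(3) E0.add)
      also have "\<dots> \<le> (4 / c * norm (e t p)) * K" using Q K by (intro mult_right_mono) auto
      finally show "norm (e t0 p) \<le> (4 * K / c) * norm (e t p)" by (simp add: mult_ac)
    qed
  qed
  then show thesis using that by blast
qed

end

subsection \<open>The Riccati gap\<close>

context symplectic_flow begin

text \<open>Junk unless \<open>e t y \<in> e t ` A\<close>; otherwise independent of the choice of \<open>j\<close>, see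
  \<open>gap_eq\<close>.\<close>

definition "gap A y t = om y (SOME j. j \<in> A \<and> e t j = e t y)"

lemma om_add_left: "t \<in> I \<Longrightarrow> om (p + q) r = om p r + om q r"
  using linear_e[of t] linear_d[of t] by (simp add: om[of t] linear_add inner_add_left)

lemma om_diff_right: "t \<in> I \<Longrightarrow> om p (q - r) = om p q - om p r"
  using linear_e[of t] linear_d[of t] by (simp add: om[of t] linear_diff inner_diff_right)

text \<open>Since \<open>q\<close> vanishes at \<open>t\<close>, \<open>om y q\<close> sees only the
  value of \<open>y\<close> at \<open>t\<close>, which is that of \<open>j\<close>; hence it equals
  \<open>om j q\<close>. Applied to the difference of two interpolating fields.\<close>

lemma om_evaluation_zero:
  assumes "t \<in> I" "e t q = 0" "lag A" "j \<in> A" "q \<in> A" "e t j = e t y"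
  shows "om y q = 0"
  using lag_sym[OF assms(3,4,5,1)] om[OF assms(1), of y q] assms by simp

lemma gap_eq:
  assumes "lag A" "t \<in> I" "j \<in> A" "e t j = e t y"
  shows "gap A y t = om y j"
proof -
  define k where "k = (SOME j. j \<in> A \<and> e t j = e t y)"
  have k: "k \<in> A" "e t k = e t y"
    using someI[of "\<lambda>j. j \<in> A \<and> e t j = e t y" j] assms by (auto simp: k_def)
  have "k - j \<in> A" using k assms lag_subspace[OF assms(1)] by (auto intro: subspace_diff)
  moreover have "e t (k - j) = 0" using k assms linear_diff[OF linear_e] by simp
  ultimately have "om y (k - j) = 0"
    using om_evaluation_zero[OF assms(2) _ assms(1) assms(3) _ assms(4)] by blast
  then show ?thesis by (simp add: gap_def k_def[symmetric] om_diff_right[OF assms(2)])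
qed

lemma gap_self: "lag A \<Longrightarrow> t \<in> I \<Longrightarrow> y \<in> A \<Longrightarrow> gap A y t = 0"
  by (simp add: gap_eq lag_om)

text \<open>Since \<open>p\<close> vanishes at \<open>t\<close>, \<open>om p j\<close> sees only the
  value of \<open>j\<close> at \<open>t\<close>, so \<open>j\<close> may be replaced by
  \<open>y\<close>; and \<open>p\<close>, \<open>y\<close> lie in the common Lagrangian
  \<open>B\<close>.\<close>

lemma gap_add_vanishing:
  assumes "lag A" "lag B" "t \<in> I" "y \<in> B" "p \<in> vanishing B t" "e t y \<in> e t ` A"
  shows "gap A (p + y) t = gap A y t"
proof -
  obtain j where j: "j \<in> A" "e t j = e t y" using assms(6) by force
  have p: "p \<in> B" "e t p = 0" using assms(5) by (auto simp: vanishing_def)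
  have "e t (p + y) = e t y" using p linear_add[OF linear_e[OF assms(3)]] by simp
  then have "gap A (p + y) t = om (p + y) j" using gap_eq[OF assms(1,3) j(1)] j by simp
  also have "\<dots> = om p j + om y j" by (rule om_add_left) fact
  also have "om p j = om p y" using p j by (simp add: om[OF assms(3)])
  also have "\<dots> = 0" using assms(2,4) p by (simp add: lag_om)
  finally show ?thesis using gap_eq[OF assms(1,3) j] by simp
qed

text \<open>If \<open>j, j + k \<in> A\<close> interpolate \<open>y\<close> at \<open>t0\<close> and at \<open>t\<close>, then \<open>gap\<close> changes by
  \<open>om y k\<close>, which the data of \<open>k\<close> at \<open>t0\<close> control.\<close>

lemma gap_increment:
  assumes "lag A" "t0 \<in> I" "t \<in> I" "j \<in> A" "e t0 j = e t0 y" "e t y \<in> e t ` A"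
  obtains k where "k \<in> A" "e t k = e t (y - j)"
    "gap A y t - gap A y t0 = - (d t0 (y - j) \<bullet> e t0 k)"
proof -
  obtain j' where j': "j' \<in> A" "e t j' = e t y" using assms(6) by force
  have k: "j' - j \<in> A" using j' assms lag_subspace[OF assms(1)] by (auto intro: subspace_diff)
  have "gap A y t - gap A y t0 = om y (j' - j)"
    using gap_eq[OF assms(1,3) j'] gap_eq[OF assms(1,2,4,5)] by (simp add: om_diff_right[OF assms(2)])
  also have "\<dots> = - (d t0 (y - j) \<bullet> e t0 (j' - j))"
    using lag_sym[OF assms(1,4) k assms(2)] assms(5) linear_diff[OF linear_d[OF assms(2)]]
    by (simp add: om[OF assms(2)] inner_diff_left)
  finally show thesis
    using that[of "j' - j"] k j' linear_diff[OF linear_e[OF assms(3)]] by simp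
qed

section \<open>Continuity, derivative and monotonicity of the gap\<close>

lemma tendsto_eval: "t0 \<in> I \<Longrightarrow> S \<subseteq> I \<Longrightarrow> ((\<lambda>t. e t p) \<longlongrightarrow> e t0 p) (at t0 within S)"
  using deriv_e[of t0 p] has_vector_derivative_continuous tendsto_within_subset
  unfolding continuous_within by blast

text \<open>The increment is governed by \<open>e t0 k\<close> for a field \<open>k\<close> in
  \<open>A\<close> with \<open>e t k = e t (y - j)\<close>. The focal estimate bounds it by a
  multiple of \<open>e t (y - j)\<close>, which tends to 0; evaluation at \<open>t0\<close> need not
  be injective on \<open>A\<close>.\<close>

lemma tendsto_gap:
  assumes "lag A" "S \<subseteq> I" "t0 \<in> S" "\<And>t. t \<in> S \<Longrightarrow> e t y \<in> e t ` A"
  shows "(gap A y \<longlongrightarrow> gap A y t0) (at t0 within S)"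
proof -
  have t0: "t0 \<in> I" using assms by blast
  obtain j where j: "j \<in> A" "e t0 j = e t0 y" using assms(4)[OF assms(3)] by force
  obtain C where C: "\<forall>\<^sub>F t in at t0 within I. \<forall>p\<in>A. norm (e t0 p) \<le> C * norm (e t p)"
    using eventually_bounded_below_focal[OF t0 assms(1)] .
  have "\<forall>\<^sub>F t in at t0 within S. \<forall>p\<in>A. norm (e t0 p) \<le> C * norm (e t p)"
    using filter_leD[OF at_le[OF assms(2)] C] .
  moreover have "\<forall>\<^sub>F t in at t0 within S. t \<in> S" by (simp add: eventually_at_filter)
  ultimately have "\<forall>\<^sub>F t in at t0 within S. norm (gap A y t - gap A y t0)
      \<le> norm (d t0 (y - j)) * (C * norm (e t (y - j)))"
  proof eventually_elim
    case (elim t)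
    obtain k where k: "k \<in> A" "e t k = e t (y - j)"
      "gap A y t - gap A y t0 = - (d t0 (y - j) \<bullet> e t0 k)"
      using gap_increment[OF assms(1) t0 _ j assms(4)[OF elim(2)]] elim(2) assms(2) by blast
    have "norm (gap A y t - gap A y t0) \<le> norm (d t0 (y - j)) * norm (e t0 k)"
      using k(3) Cauchy_Schwarz_ineq2[of "d t0 (y - j)" "e t0 k"] by simp
    also have "\<dots> \<le> norm (d t0 (y - j)) * (C * norm (e t (y - j)))"
      using elim(1) k by (intro mult_left_mono) auto
    finally show ?case .
  qed
  moreover have "e t0 (y - j) = 0" using j linear_diff[OF linear_e[OF t0]] by simp
  then have "((\<lambda>t. norm (d t0 (y - j)) * (C * norm (e t (y - j)))) \<longlongrightarrow> 0) (at t0 within S)"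
    using tendsto_eval[OF t0 assms(2), of "y - j"] by (auto intro!: tendsto_eq_intros)
  ultimately have "((\<lambda>t. gap A y t - gap A y t0) \<longlongrightarrow> 0) (at t0 within S)"
    by (rule Lim_null_comparison)
  then show ?thesis by (simp add: LIM_zero_iff)
qed

text \<open>Near a non-focal point the field \<open>k\<close> of \<open>gap_increment\<close> tends
  to 0, as evaluation is bounded below. Hence \<open>e t0 k\<close> is (t - t0)
  \<open>d t0 (y - j)\<close> to first order, and pairing it with \<open>d t0 (y - j)\<close> gives
  the square.\<close>

lemma has_real_derivative_gap:
  assumes "lag A" "S \<subseteq> I" "t0 \<in> S" "\<And>t. t \<in> S \<Longrightarrow> e t y \<in> e t ` A"
    and j: "j \<in> A" "e t0 j = e t0 y" and nf: "vanishing A t0 \<subseteq> {0}"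
  shows "(gap A y has_real_derivative - (norm (d t0 (y - j)))\<^sup>2) (at t0 within S)"
proof -
  have t0: "t0 \<in> I" using assms by blast
  define w where "w = y - j"
  have w0: "e t0 w = 0" using j linear_diff[OF linear_e[OF t0]] by (simp add: w_def)
  obtain c where c: "c > 0" "\<forall>\<^sub>F t in at t0 within I. \<forall>p\<in>A. c * norm p \<le> norm (e t p)"
    using eventually_bounded_below_nonfocal[OF t0 lag_subspace[OF assms(1)] nf] .
  have "bounded_linear (d t0)" using linear_d[OF t0] linear_conv_bounded_linear by blast
  then obtain L where L: "L > 0" "\<And>p. norm (d t0 p) \<le> norm p * L"
    using bounded_linear.pos_bounded by blast
  define r where "r t = norm (e t w - e t0 w - (t - t0) *\<^sub>R d t0 w) / norm (t - t0)" for t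
  \<comment> \<open>\<open>r t\<close> is the remainder of \<open>w\<close>; the 1 pays for the
    remainder of \<open>k\<close>, taken at rate 1, and \<open>L\<close> for
    \<open>d t0 k\<close>.\<close>
  define b where "b t = norm (d t0 w) * (r t + (1 + L) * (norm (e t w) / c))" for t
  have "(r \<longlongrightarrow> 0) (at t0 within I)"
    using deriv_e[OF t0, of w] unfolding r_def has_vector_derivative_def has_derivative_iff_norm by simp
  then have "(r \<longlongrightarrow> 0) (at t0 within S)" using assms(2) tendsto_within_subset by blast
  then have b0: "(b \<longlongrightarrow> 0) (at t0 within S)"
    unfolding b_def using tendsto_eval[OF t0 assms(2), of w] w0 c(1) by (auto intro!: tendsto_eq_intros)
  have "\<forall>\<^sub>F t in at t0 within S. t \<in> S \<and> t \<noteq> t0" by (simp add: eventually_at_filter)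
  with filter_leD[OF at_le[OF assms(2)] c(2)] filter_leD[OF at_le[OF assms(2)] eval_remainder[OF t0 zero_less_one]]
  have "\<forall>\<^sub>F t in at t0 within S.
      norm ((gap A y t - gap A y t0) / (t - t0) - - (norm (d t0 w))\<^sup>2) \<le> b t"
  proof eventually_elim
    case (elim t)
    then have t: "t \<in> I" "t \<noteq> t0" using assms(2) by auto
    obtain k where k: "k \<in> A" "e t k = e t w" "gap A y t - gap A y t0 = - (d t0 w \<bullet> e t0 k)"
      using gap_increment[OF assms(1) t0 t(1) j assms(4)] elim(3) unfolding w_def by blast
    let ?\<tau> = "t - t0"
    define r1 where "r1 = e t w - e t0 w - ?\<tau> *\<^sub>R d t0 w"
    define r2 where "r2 = e t k - e t0 k - ?\<tau> *\<^sub>R d t0 k"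
    have e0k: "e t0 k = ?\<tau> *\<^sub>R d t0 w + (r1 - r2 - ?\<tau> *\<^sub>R d t0 k)"
      using w0 k(2) by (simp add: r1_def r2_def)
    have "(gap A y t - gap A y t0) / ?\<tau> - - (norm (d t0 w))\<^sup>2 = - (d t0 w \<bullet> (r1 - r2 - ?\<tau> *\<^sub>R d t0 k)) / ?\<tau>"
    proof -
      have *: "- (\<tau> * a + b) / \<tau> - - a = - b / \<tau>" if "\<tau> \<noteq> 0" for \<tau> a b :: real
        using that by (simp add: field_simps)
      show ?thesis
        unfolding k(3) power2_norm_eq_inner
        by (subst e0k) (use t(2) in \<open>simp only: inner_add_right inner_scaleR_right * right_minus_eq not_False_eq_True\<close>)
    qed
    then have "norm ((gap A y t - gap A y t0) / ?\<tau> - - (norm (d t0 w))\<^sup>2)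
        = \<bar>d t0 w \<bullet> (r1 - r2 - ?\<tau> *\<^sub>R d t0 k)\<bar> / \<bar>?\<tau>\<bar>" by simp
    also have "\<dots> \<le> norm (d t0 w) * norm (r1 - r2 - ?\<tau> *\<^sub>R d t0 k) / \<bar>?\<tau>\<bar>"
      by (intro divide_right_mono Cauchy_Schwarz_ineq2) simp
    also have "norm (r1 - r2 - ?\<tau> *\<^sub>R d t0 k) \<le> r t * \<bar>?\<tau>\<bar> + \<bar>?\<tau>\<bar> * norm k + \<bar>?\<tau>\<bar> * (norm k * L)"
    proof -
      have "norm (r1 - r2 - ?\<tau> *\<^sub>R d t0 k) \<le> norm r1 + norm r2 + norm (?\<tau> *\<^sub>R d t0 k)"
        using norm_triangle_ineq4[of r1 r2] norm_triangle_ineq4[of "r1 - r2" "?\<tau> *\<^sub>R d t0 k"] by simp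
      moreover have "norm r1 = r t * \<bar>?\<tau>\<bar>" using t(2) by (simp add: r_def r1_def)
      moreover have "norm r2 \<le> \<bar>?\<tau>\<bar> * norm k" using elim(2)[rule_format, of k] by (simp add: r2_def)
      moreover have "norm (?\<tau> *\<^sub>R d t0 k) \<le> \<bar>?\<tau>\<bar> * (norm k * L)" using L(2)[of k] by (simp add: mult_left_mono)
      ultimately show ?thesis by linarith
    qed
    also have "norm (d t0 w) * (r t * \<bar>?\<tau>\<bar> + \<bar>?\<tau>\<bar> * norm k + \<bar>?\<tau>\<bar> * (norm k * L)) / \<bar>?\<tau>\<bar>
        = norm (d t0 w) * (r t + (1 + L) * norm k)"
      using t(2) by (simp add: field_simps)
    also have "\<dots> \<le> b t"
    proof -
      have "norm k \<le> norm (e t w) / c" using elim(1)[rule_format, OF k(1)] k(2) c(1) by (simp add: field_simps)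
      then show ?thesis unfolding b_def using L by (intro mult_left_mono add_left_mono) auto
    qed
    finally show ?case by (simp add: divide_right_mono mult_left_mono)
  qed
  then have "((\<lambda>t. (gap A y t - gap A y t0) / (t - t0) - - (norm (d t0 w))\<^sup>2) \<longlongrightarrow> 0) (at t0 within S)"
    using b0 by (rule Lim_null_comparison)
  then show ?thesis
    unfolding has_field_derivative_iff w_def[symmetric] by (simp only: LIM_zero_iff)
qed

text \<open>The derivative is available only off the finite set \<open>G\<close>, but
  \<open>gap\<close> is continuous across it, so it is still the integral of its derivative.\<close>

lemma gap_antimono:
  assumes "lag A" "{s..t} \<subseteq> I" "s \<le> t" "finite G"
    and val: "\<And>x. x \<in> {s..t} \<Longrightarrow> e x y \<in> e x ` A"
    and nf: "\<And>x. x \<in> {s..t} - G \<Longrightarrow> vanishing A x \<subseteq> {0}"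
  shows "gap A y t \<le> gap A y s"
proof -
  have "\<forall>x\<in>{s..t}. \<exists>j. j \<in> A \<and> e x j = e x y" using val by force
  then obtain j where j: "\<And>x. x \<in> {s..t} \<Longrightarrow> j x \<in> A \<and> e x (j x) = e x y" by metis
  have "((\<lambda>x. - (norm (d x (y - j x)))\<^sup>2) has_integral (gap A y t - gap A y s)) {s..t}"
  proof (rule fundamental_theorem_of_calculus_interior_strong[OF assms(4,3)])
    show "continuous_on {s..t} (gap A y)"
      unfolding continuous_on_def using tendsto_gap[OF assms(1,2) _ val] by blast
    fix x assume x: "x \<in> {s<..<t} - G"
    then have "(gap A y has_real_derivative - (norm (d x (y - j x)))\<^sup>2) (at x within {s..t})"
      using j[of x] nf[of x] by (intro has_real_derivative_gap[OF assms(1,2) _ val]) auto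
    then show "(gap A y has_vector_derivative - (norm (d x (y - j x)))\<^sup>2) (at x)"
      using x at_within_Icc_at[of s x t] by (simp add: has_real_derivative_iff_has_vector_derivative)
  qed
  then have "gap A y t - gap A y s \<le> 0"
    by (rule has_integral_le[OF _ has_integral_0]) simp
  then show ?thesis by simp
qed

text \<open>Monotonicity makes the gap constant, so its derivative vanishes at a non-focal interior
  point. There \<open>y\<close> and its interpolating field have the same value and the same
  derivative, hence coincide.\<close>

lemma mem_of_gap_le:
  assumes "lag A" "{s..t} \<subseteq> I" "s < t" "finite G"
    and val: "\<And>x. x \<in> {s..t} \<Longrightarrow> e x y \<in> e x ` A"
    and nf: "\<And>x. x \<in> {s..t} - G \<Longrightarrow> vanishing A x \<subseteq> {0}"
    and le: "gap A y s \<le> gap A y t"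
  shows "y \<in> A"
proof -
  have mono: "gap A y v \<le> gap A y u" if "s \<le> u" "u \<le> v" "v \<le> t" for u v
    using that assms(2) val nf by (intro gap_antimono[OF assms(1) _ that(2) assms(4)]) auto
  have const: "gap A y x = gap A y s" if "x \<in> {s..t}" for x
    using mono[of s x] mono[of x t] that le by auto
  have "infinite ({s<..<t} - G)"
    using assms(3,4) by (simp add: infinite_Ioo Diff_infinite_finite)
  then obtain x where x: "x \<in> {s<..<t}" "x \<notin> G"
    using infinite_imp_nonempty by blast
  then obtain j where j: "j \<in> A" "e x j = e x y" using val[of x] by force
  have xI: "x \<in> I" using x assms(2) by auto
  have "(gap A y has_real_derivative - (norm (d x (y - j)))\<^sup>2) (at x within {s..t})"
    using x nf[of x] by (intro has_real_derivative_gap[OF assms(1,2) _ val j]) auto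
  moreover have "(gap A y has_real_derivative 0) (at x within {s..t})"
  proof (rule has_field_derivative_transform_within)
    show "((\<lambda>_. gap A y s) has_real_derivative 0) (at x within {s..t})" by simp
    show "gap A y s = gap A y u" if "u \<in> {s..t}" for u using const[OF that] by simp
    show "x \<in> {s..t}" using x by simp
  qed (rule zero_less_one)
  moreover have "at x within {s..t} = at x"
    using x by (intro at_within_Icc_at) auto
  ultimately have "- (norm (d x (y - j)))\<^sup>2 = 0"
    using DERIV_unique by metis
  then have "d x (y - j) = 0" by simp
  moreover have "e x (y - j) = 0" using j linear_diff[OF linear_e[OF xI]] by simp
  ultimately have "y - j = 0" using data_inj[OF xI] by blast
  then show ?thesis using j by simp
qed

end

subsection \<open>Broken Jacobi fields\<close>

context symplectic_flow begin

text \<open>Induction from right to left: each new time \<open>b\<close> precedes those already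
  treated. Nonnegativity and the equality case go together, since equality at \<open>a\<close>
  reaches the later fields only because the gap at \<open>b\<close> is squeezed between 0 and the
  gap at \<open>a\<close>.\<close>

lemma piecewise_gap:
  assumes A: "lag A" and B: "lag B" and I0: "is_interval I0" "I0 \<subseteq> I" and G: "finite G"
    and nf: "\<And>t. t \<in> I0 - G \<Longrightarrow> vanishing A t \<subseteq> {0}"
    and F: "finite F" "F \<subseteq> I0" "\<And>t. t \<in> F \<Longrightarrow> J t \<in> vanishing B t"
    and a: "a \<in> I0" "\<forall>t\<in>F. a < t"
    and val: "\<And>t. t \<in> I0 \<Longrightarrow> a \<le> t \<Longrightarrow> e t (\<Sum>s\<in>{s\<in>F. t \<le> s}. J s) \<in> e t ` A"
  shows "0 \<le> gap A (\<Sum>s\<in>F. J s) a \<and> (gap A (\<Sum>s\<in>F. J s) a \<le> 0 \<longrightarrow> (\<forall>t\<in>F. J t \<in> A))"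
  using F a val
proof (induction F arbitrary: a rule: finite_linorder_min_induct)
  case empty
  then show ?case
    using gap_self[OF A _ subspace_0[OF lag_subspace[OF A]], of a] I0(2) by auto
next
  case (insert b F)
  let ?X = "\<Sum>s\<in>insert b F. J s" and ?X' = "\<Sum>s\<in>F. J s"
  have notin: "b \<notin> F" using insert.hyps(2) by blast
  have b: "b \<in> I0" "b \<in> I" "a < b" using insert.prems I0 by auto
  have Jb: "J b \<in> vanishing B b" using insert.prems by blast
  have ab: "{a..b} \<subseteq> I0"
    using mem_is_interval_1_I[OF I0(1) insert.prems(3) b(1)] by auto
  have X: "?X = J b + ?X'" using insert.hyps notin by simp
  have "e t (\<Sum>s\<in>{s\<in>F. t \<le> s}. J s) \<in> e t ` A" if t: "t \<in> I0" "b \<le> t" for t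
  proof (cases "t = b")
    \<comment> \<open>The hypothesis at \<open>b\<close> is about a sum still containing
      \<open>J b\<close>, which contributes no value there.\<close>
    case True
    have "{s \<in> insert b F. b \<le> s} = insert b F" "{s \<in> F. b \<le> s} = F"
      using insert.hyps by auto
    then have "e b (J b + ?X') \<in> e b ` A"
      using insert.prems(5)[of b] b X by simp
    moreover have "e b (J b) = 0" using Jb by (simp add: vanishing_def)
    ultimately show ?thesis
      using True \<open>{s \<in> F. b \<le> s} = F\<close> linear_add[OF linear_e[OF b(2)]] by simp
  next
    case False
    then have "{s \<in> insert b F. t \<le> s} = {s \<in> F. t \<le> s}" using t by auto
    then show ?thesis using insert.prems(5)[of t] t b(3) by simp
  qed
  note val' = this
  have IH: "0 \<le> gap A ?X' b \<and> (gap A ?X' b \<le> 0 \<longrightarrow> (\<forall>t\<in>F. J t \<in> A))"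
    using insert.prems insert.hyps b(1) val' by (intro insert.IH) auto
  have valX: "e x ?X \<in> e x ` A" if "x \<in> {a..b}" for x
  proof -
    have "{s \<in> insert b F. x \<le> s} = insert b F" using insert.hyps(2) that by fastforce
    then show ?thesis using insert.prems(5)[of x] that ab by auto
  qed
  have X'B: "?X' \<in> B"
    using insert.prems(2) by (intro subspace_sum[OF lag_subspace[OF B]]) (auto simp: vanishing_def)
  have valX': "e b ?X' \<in> e b ` A"
  proof -
    have "{s \<in> F. b \<le> s} = F" using insert.hyps by auto
    then show ?thesis using val'[OF b(1)] by simp
  qed
  have jump: "gap A ?X b = gap A ?X' b"
    unfolding X by (rule gap_add_vanishing[OF A B b(2) X'B Jb valX'])
  have abI: "{a..b} \<subseteq> I" using ab I0(2) by blast
  have nfab: "vanishing A x \<subseteq> {0}" if "x \<in> {a..b} - G" for x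
    using nf[of x] that ab by blast
  have mono: "gap A ?X b \<le> gap A ?X a"
    by (rule gap_antimono[OF A abI less_imp_le[OF b(3)] G valX nfab])
  show ?case
  proof (intro conjI impI)
    show "0 \<le> gap A ?X a" using mono IH jump by linarith
    assume le: "gap A ?X a \<le> 0"
    have F: "\<forall>t\<in>F. J t \<in> A" using IH mono jump le by auto
    then have "?X' \<in> A" by (intro subspace_sum[OF lag_subspace[OF A]]) auto
    moreover have "?X \<in> A"
      using IH jump le by (intro mem_of_gap_le[OF A abI b(3) G valX nfab]) auto
    ultimately have "?X - ?X' \<in> A" by (intro subspace_diff[OF lag_subspace[OF A]])
    then show "\<forall>t\<in>insert b F. J t \<in> A" using F X by simp
  qed
qed

lemma piecewise_mem:
  assumes A: "lag A" and B: "lag B" and I0: "is_interval I0" "I0 \<subseteq> I" and G: "finite G"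
    and nf: "\<And>t. t \<in> I0 - G \<Longrightarrow> vanishing A t \<subseteq> {0}"
    and F: "finite F" "F \<subseteq> I0" "\<And>t. t \<in> F \<Longrightarrow> J t \<in> vanishing B t"
    and start: "(\<Sum>s\<in>F. J s) \<in> A"
    and val: "\<And>t. t \<in> I0 \<Longrightarrow> e t (\<Sum>s\<in>{s\<in>F. t \<le> s}. J s) \<in> e t ` A"
    and t: "t \<in> F"
  shows "J t \<in> A"
proof -
  \<comment> \<open>\<open>I0\<close> may have no point before the first break, so the argument
    starts at that break with the remaining fields: \<open>J b\<close> does not change the gap
    there, and the full sum, lying in \<open>A\<close>, has gap 0.\<close>
  define b where "b = Min F"
  define F' where "F' = F - {b}"
  have b: "b \<in> F" unfolding b_def using F t by (intro Min_in) auto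
  have bI: "b \<in> I0" "b \<in> I" using b F I0 by auto
  have Fb: "F = insert b F'" "b \<notin> F'" "finite F'" using b F by (auto simp: F'_def)
  have less: "\<forall>t\<in>F'. b < t"
    using F by (auto simp: F'_def b_def order_less_le)
  have X: "(\<Sum>s\<in>F. J s) = J b + (\<Sum>s\<in>F'. J s)" using Fb by simp
  have Jb: "J b \<in> vanishing B b" "e b (J b) = 0" using F(3)[OF b] by (auto simp: vanishing_def)
  have eb: "e b (\<Sum>s\<in>F. J s) = e b (\<Sum>s\<in>F'. J s)"
    unfolding X using Jb linear_add[OF linear_e[OF bI(2)]] by simp
  have valF': "e t (\<Sum>s\<in>{s\<in>F'. t \<le> s}. J s) \<in> e t ` A" if "t \<in> I0" "b \<le> t" for t
  proof (cases "t = b")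
    case True
    have "{s \<in> F'. b \<le> s} = F'" using less by auto
    then show ?thesis using True eb start by (metis imageI)
  next
    case False
    then have "{s \<in> F'. t \<le> s} = {s \<in> F. t \<le> s}" using Fb that by auto
    then show ?thesis using val that by simp
  qed
  have X'B: "(\<Sum>s\<in>F'. J s) \<in> B"
    using F(3) Fb by (intro subspace_sum[OF lag_subspace[OF B]]) (auto simp: vanishing_def)
  have "gap A (\<Sum>s\<in>F'. J s) b = gap A (\<Sum>s\<in>F. J s) b"
    unfolding X by (rule gap_add_vanishing[OF A B bI(2) X'B Jb(1), symmetric]) (metis eb start imageI)
  also have "\<dots> = 0" by (rule gap_self[OF A bI(2) start])
  finally have "\<forall>t\<in>F'. J t \<in> A"
    using piecewise_gap[OF A B I0 G nf Fb(3) _ _ bI(1) less valF'] F Fb by force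
  moreover from this have "(\<Sum>s\<in>F'. J s) \<in> A" by (intro subspace_sum[OF lag_subspace[OF A]]) auto
  then have "J b \<in> A" using subspace_diff[OF lag_subspace[OF A] start] X by fastforce
  ultimately show ?thesis using t Fb by auto
qed

text \<open>With more unknowns than equations, a nontrivial solution would give fields
  \<open>J t\<close> that \<open>piecewise_mem\<close> places in \<open>A\<close>, hence in
  \<open>N t\<close>. Being orthogonal to \<open>N t\<close> by construction they vanish, against
  independence.\<close>

lemma sum_vanishing_le:
  assumes A: "lag A" and B: "lag B" and I0: "is_interval I0" "I0 \<subseteq> I"
    and G: "finite G" "G \<subseteq> I0" and nf: "\<And>t. t \<in> I0 - G \<Longrightarrow> vanishing A t \<subseteq> {0}"
    and F: "finite F" "F \<subseteq> I0"
  shows "(\<Sum>t\<in>F. dim (vanishing B t)) + dim (B \<inter> A) \<le> (\<Sum>t\<in>G. dim (vanishing A t)) + dim B"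
proof -
  note sA = lag_subspace[OF A] and sB = lag_subspace[OF B]
  define N where "N t = vanishing (B \<inter> A) t" for t
  have sI: "subspace (B \<inter> A)" using sA sB by (rule subspace_inter[rotated])
  have sN: "subspace (N t)" "N t \<subseteq> vanishing A t" "N t \<subseteq> vanishing B t"
    "subspace (vanishing A t)" "subspace (vanishing B t)" if "t \<in> I0" for t
    using that I0(2) sA sB sI by (auto simp: N_def intro!: subspace_vanishing) (auto simp: vanishing_def)
  have "\<forall>t\<in>I0. \<exists>C. finite C \<and> independent C \<and> C \<subseteq> vanishing B t \<and>
      card C + dim (N t) = dim (vanishing B t) \<and> (\<forall>x\<in>N t. \<forall>y\<in>span C. x \<bullet> y = 0)"
  proof
    fix t assume "t \<in> I0"
    note sN = sN[OF this]
    show "\<exists>C. finite C \<and> independent C \<and> C \<subseteq> vanishing B t \<and>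
      card C + dim (N t) = dim (vanishing B t) \<and> (\<forall>x\<in>N t. \<forall>y\<in>span C. x \<bullet> y = 0)"
      using orthogonal_complement_basis[OF sN(5,1,3)] by metis
  qed
  from bchoice[OF this] obtain U where U0: "\<forall>t\<in>I0. finite (U t) \<and> independent (U t) \<and>
      U t \<subseteq> vanishing B t \<and> card (U t) + dim (N t) = dim (vanishing B t) \<and>
      (\<forall>x\<in>N t. \<forall>y\<in>span (U t). x \<bullet> y = 0)" by (rule exE)
  have U: "\<And>t. t \<in> I0 \<Longrightarrow> finite (U t)" "\<And>t. t \<in> I0 \<Longrightarrow> independent (U t)"
    "\<And>t. t \<in> I0 \<Longrightarrow> U t \<subseteq> vanishing B t"
    "\<And>t. t \<in> I0 \<Longrightarrow> card (U t) + dim (N t) = dim (vanishing B t)"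
    "\<And>t x y. t \<in> I0 \<Longrightarrow> x \<in> N t \<Longrightarrow> y \<in> span (U t) \<Longrightarrow> x \<bullet> y = 0"
    using U0 by blast+
  have "\<forall>t\<in>I0. \<exists>C. finite C \<and> card C + dim (N t) = dim (vanishing A t) \<and>
      (\<forall>v\<in>vanishing A t. \<exists>x\<in>N t. \<exists>y\<in>span C. v = x + y)"
  proof
    fix t assume "t \<in> I0"
    note sN = sN[OF this]
    show "\<exists>C. finite C \<and> card C + dim (N t) = dim (vanishing A t) \<and>
      (\<forall>v\<in>vanishing A t. \<exists>x\<in>N t. \<exists>y\<in>span C. v = x + y)"
      by (rule orthogonal_complement_basis[OF sN(4,1,2)]) blast
  qed
  from bchoice[OF this] obtain V where V0: "\<forall>t\<in>I0. finite (V t) \<and>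
      card (V t) + dim (N t) = dim (vanishing A t) \<and>
      (\<forall>v\<in>vanishing A t. \<exists>x\<in>N t. \<exists>y\<in>span (V t). v = x + y)" by (rule exE)
  have V: "\<And>t. t \<in> I0 \<Longrightarrow> finite (V t)"
    "\<And>t. t \<in> I0 \<Longrightarrow> card (V t) + dim (N t) = dim (vanishing A t)"
    "\<And>t v. t \<in> I0 \<Longrightarrow> v \<in> vanishing A t \<Longrightarrow> \<exists>x\<in>N t. \<exists>y\<in>span (V t). v = x + y"
    using V0 by blast+
  obtain W where W: "finite W" "card W + dim (B \<inter> A) = dim B"
    "\<And>x y. x \<in> B \<inter> A \<Longrightarrow> y \<in> span W \<Longrightarrow> x \<bullet> y = 0"
    "\<And>v. v \<in> B \<Longrightarrow> \<exists>x\<in>B \<inter> A. \<exists>y\<in>span W. v = x + y"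
    using orthogonal_complement_basis[OF sB sI Int_lower1] by metis
  \<comment> \<open>Unknowns are the coefficients of each \<open>J t\<close> along
    \<open>U t\<close>. The equation \<open>Inr q\<close> makes the total orthogonal to
    \<open>q\<close>; \<open>Inl (t, k)\<close> makes the value at \<open>t\<close> of the sum over
    times from \<open>t\<close> on orthogonal to \<open>d t k\<close>, as
    \<open>mem_values_lag\<close> asks.\<close>
  define S where "S = Sigma F U"
  define T where "T = Sigma G V <+> W"
  define coeff where "coeff i = (\<lambda>(s, b). case i of
      Inl (t, k) \<Rightarrow> if t \<le> s then e t b \<bullet> d t k else 0 | Inr q \<Rightarrow> b \<bullet> q)" for i
  have fin: "finite S" "finite T"
    using F G U(1) V(1) W(1) by (auto simp: S_def T_def intro!: finite_SigmaI)
  have "card S \<le> card T"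
  proof (rule ccontr)
    assume "\<not> card S \<le> card T"
    then obtain c where c: "\<exists>s\<in>S. c s \<noteq> 0" "\<And>i. i \<in> T \<Longrightarrow> (\<Sum>s\<in>S. coeff i s * c s) = 0"
      using homogeneous_system_nontrivial_solution[OF fin(2,1), of coeff] by (metis not_le)
    define J where "J t = (\<Sum>b\<in>U t. c (t, b) *\<^sub>R b)" for t
    have Jspan: "J t \<in> span (U t)" for t
      unfolding J_def by (intro span_sum span_scale span_base)
    have Jvan: "J t \<in> vanishing B t" if "t \<in> I0" for t
      using Jspan[of t] span_minimal[OF U(3)[OF that] sN(5)[OF that]] by blast
    have JB: "J t \<in> B" if "t \<in> I0" for t using Jvan[OF that] by (simp add: vanishing_def)
    have sumS: "(\<Sum>s\<in>S. f s) = (\<Sum>t\<in>F. \<Sum>b\<in>U t. f (t, b))" for f :: "_ \<Rightarrow> real"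
      unfolding S_def using F U(1) by (subst sum.Sigma) auto
    have "(\<Sum>s\<in>F. J s) \<bullet> q = 0" if "q \<in> W" for q
      using c(2)[unfolded T_def, OF InrI[OF that]]
      by (simp add: sumS coeff_def J_def inner_sum_left mult.commute)
    then have "span W \<subseteq> {y. (\<Sum>s\<in>F. J s) \<bullet> y = 0}"
      by (intro span_minimal subspace_hyperplane) auto
    then have W0: "(\<Sum>s\<in>F. J s) \<bullet> y = 0" if "y \<in> span W" for y
      using that by blast
    have "(\<Sum>s\<in>F. J s) \<in> B" using F JB by (intro subspace_sum[OF sB]) auto
    then obtain x y where xy: "x \<in> B \<inter> A" "y \<in> span W" "(\<Sum>s\<in>F. J s) = x + y" using W(4) by blast
    \<comment> \<open>The equations \<open>Inr\<close> kill the component of the total along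
      \<open>span W\<close>, leaving the one in \<open>B \<inter> A\<close>.\<close>
    have "y \<bullet> y = 0" using W0[OF xy(2)] W(3)[OF xy(1,2)] by (simp add: xy(3) inner_add_left)
    then have start: "(\<Sum>s\<in>F. J s) \<in> A" using xy by simp
    have val: "e t (\<Sum>s\<in>{s\<in>F. t \<le> s}. J s) \<in> e t ` A" if t: "t \<in> I0" for t
    proof (cases "t \<in> G")
      case False
      then show ?thesis using values_lag_UNIV[OF A _ nf[of t]] t I0(2) by auto
    next
      case True
      have tI: "t \<in> I" using t I0(2) by blast
      interpret E: linear "e t" by (rule linear_e[OF tI])
      interpret D: linear "d t" by (rule linear_d[OF tI])
      let ?X = "\<Sum>s\<in>{s\<in>F. t \<le> s}. J s"
      have XB: "?X \<in> B" using F JB by (intro subspace_sum[OF sB]) auto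
      have "e t ?X \<bullet> d t k = 0" if k: "k \<in> V t" for k
      proof -
        have "e t ?X = (\<Sum>s\<in>{s\<in>F. t \<le> s}. \<Sum>b\<in>U s. c (s, b) *\<^sub>R e t b)"
          by (simp add: E.sum J_def E.scale)
        then have "e t ?X \<bullet> d t k = (\<Sum>s\<in>{s\<in>F. t \<le> s}. \<Sum>b\<in>U s. c (s, b) * (e t b \<bullet> d t k))"
          by (simp add: inner_sum_left)
        also have "\<dots> = (\<Sum>s\<in>F. \<Sum>b\<in>U s. (if t \<le> s then e t b \<bullet> d t k else 0) * c (s, b))"
          using F(1) by (simp add: sum.inter_filter mult.commute)
            (intro sum.cong refl, auto simp: mult.commute)
        also have "\<dots> = 0"
          using c(2)[unfolded T_def, OF InlI[OF SigmaI[where B = V, OF True k]]] by (simp add: sumS coeff_def)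
        finally show ?thesis .
      qed
      moreover have "subspace {y. e t ?X \<bullet> d t y = 0}"
        by (rule subspaceI) (simp_all add: inner_add_right D.add D.scale D.zero)
      ultimately have "span (V t) \<subseteq> {y. e t ?X \<bullet> d t y = 0}"
        by (intro span_minimal) auto
      then have V0: "e t ?X \<bullet> d t y = 0" if "y \<in> span (V t)" for y
        using that by blast
      show ?thesis
      proof (rule mem_values_lag[OF A tI])
        fix p assume "p \<in> vanishing A t"
        then obtain x y where xy: "x \<in> N t" "y \<in> span (V t)" "p = x + y" using V(3)[OF t] by blast
        have "x \<in> B" "e t x = 0" using xy(1) by (auto simp: N_def vanishing_def)
        \<comment> \<open>No equation is spent on \<open>N t\<close>: \<open>x\<close> and the
          partial sum both lie in \<open>B\<close>, and \<open>x\<close> vanishes at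
          \<open>t\<close>.\<close>
        then have "e t ?X \<bullet> d t x = 0" using lag_sym[OF B XB _ tI, of x] by simp
        then show "e t ?X \<bullet> d t p = 0" using V0[OF xy(2)] by (simp add: xy(3) D.add inner_add_right)
      qed
    qed
    have JA: "J t \<in> A" if "t \<in> F" for t
      by (rule piecewise_mem[OF A B I0 G(1) nf F _ start val that]) (use Jvan F(2) in auto)
    have J0: "J t = 0" if "t \<in> F" for t
    proof -
      have t: "t \<in> I0" using that F(2) by blast
      have "J t \<in> N t" using JA[OF that] Jvan[OF t] by (auto simp: N_def vanishing_def)
      then show ?thesis using U(5)[OF t _ Jspan[of t]] by (metis inner_eq_zero_iff)
    qed
    have "c (t, b) = 0" if "t \<in> F" "b \<in> U t" for t b
    proof -
      have t: "t \<in> I0" using that F(2) by blast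
      show ?thesis
        using independentD[OF U(2)[OF t] U(1)[OF t] subset_refl, of "\<lambda>b. c (t, b)" b] J0[OF that(1)] that(2)
        by (simp add: J_def)
    qed
    then show False using c(1) by (auto simp: S_def)
  qed
  have cS: "card S + (\<Sum>t\<in>F. dim (N t)) = (\<Sum>t\<in>F. dim (vanishing B t))"
  proof -
    have "card S = (\<Sum>t\<in>F. card (U t))" unfolding S_def using F U(1) by (subst card_SigmaI) auto
    then show ?thesis using U(4) F(2) by (simp add: sum.distrib[symmetric] subset_iff)
  qed
  have cT: "card T + (\<Sum>t\<in>G. dim (N t)) + dim (B \<inter> A) = (\<Sum>t\<in>G. dim (vanishing A t)) + dim B"
  proof -
    have "card (Sigma G V) = (\<Sum>t\<in>G. card (V t))" using G V(1) by (subst card_SigmaI) auto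
    moreover have "card T = card (Sigma G V) + card W"
      unfolding T_def using G V(1) W(1) by (subst card_Plus) auto
    moreover have "(\<Sum>t\<in>G. card (V t)) + (\<Sum>t\<in>G. dim (N t)) = (\<Sum>t\<in>G. dim (vanishing A t))"
      using V(2) G(2) by (simp add: sum.distrib[symmetric] subset_iff)
    ultimately show ?thesis using W(2) by simp
  qed
  \<comment> \<open>\<open>N t\<close> lies in \<open>vanishing A t\<close>, trivial off
    \<open>G\<close>. Hence the dimensions saved among the unknowns over \<open>F\<close> are at
    most those saved among the equations over \<open>G\<close>.\<close>
  have "dim (N t) = 0" if "t \<in> F - G" for t
    using that F(2) nf[of t] sN(2)[of t] by auto
  then have "(\<Sum>t\<in>F. dim (N t)) = (\<Sum>t\<in>F \<inter> G. dim (N t))"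
    using F(1) by (intro sum.mono_neutral_right) auto
  also have "\<dots> \<le> (\<Sum>t\<in>G. dim (N t))" using G(1) by (intro sum_mono2) auto
  finally show ?thesis using \<open>card S \<le> card T\<close> cS cT by linarith
qed

end

subsection \<open>Jacobi fields\<close>

context
  fixes I :: "real set" and R :: "real \<Rightarrow> 'v::euclidean_space \<Rightarrow>\<^sub>L 'v"
  assumes I: "is_interval I" "interior I \<noteq> {}" and R: "continuous_on I R"
begin

text \<open>An interval with interior has no isolated points, so derivatives within it are unique,
  endpoints included.\<close>

lemma deriv_on_eqI: "t \<in> I \<Longrightarrow> (f has_vector_derivative D) (at t within I) \<Longrightarrow> deriv_on I f t = D"
proof -
  assume t: "t \<in> I" and f: "(f has_vector_derivative D) (at t within I)"
  have "I \<noteq> {x}" for x using I(2) by auto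
  then have "t islimpt I" using connected_imp_perfect[OF is_interval_connected[OF I(1)] t] by blast
  then have "at t within I \<noteq> bot" by (simp add: trivial_limit_within)
  then show ?thesis unfolding deriv_on_def using f by (rule vector_derivative_within)
qed

lemma Jac_outside: "J \<in> Jac I R \<Longrightarrow> t \<notin> I \<Longrightarrow> J t = 0"
  by (simp add: Jac_def)

lemma Jac_derivs:
  assumes "J \<in> Jac I R" "t \<in> I"
  shows "(J has_vector_derivative deriv_on I J t) (at t within I)"
    "(deriv_on I J has_vector_derivative - R t (J t)) (at t within I)"
proof -
  have "deriv_on I (deriv_on I J) t = - R t (J t)"
    using assms by (simp add: Jac_def eq_neg_iff_add_eq_0)
  then show "(J has_vector_derivative deriv_on I J t) (at t within I)"
    "(deriv_on I J has_vector_derivative - R t (J t)) (at t within I)"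
    using deriv_on_works[of J I t] deriv_on_works[of "deriv_on I J" I t] assms
    by (simp_all add: Jac_def)
qed

lemma JacI:
  assumes J: "\<And>t. t \<in> I \<Longrightarrow> (J has_vector_derivative K t) (at t within I)"
    and K: "\<And>t. t \<in> I \<Longrightarrow> (K has_vector_derivative - R t (J t)) (at t within I)"
    and "\<And>t. t \<notin> I \<Longrightarrow> J t = 0"
  shows "J \<in> Jac I R" "\<And>t. t \<in> I \<Longrightarrow> deriv_on I J t = K t"
proof -
  show D: "deriv_on I J t = K t" if "t \<in> I" for t using deriv_on_eqI[OF that J[OF that]] .
  have K': "(deriv_on I J has_vector_derivative - R t (J t)) (at t within I)" if "t \<in> I" for t
    using has_vector_derivative_transform_within[OF K[OF that] zero_less_one that] D by simp
  show "J \<in> Jac I R"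
    unfolding Jac_def using J K' assms(3) deriv_on_eqI[OF _ K']
    by (auto simp: differentiable_on_def intro: differentiableI_vector)
qed

lemma Jac_add: "J \<in> Jac I R \<Longrightarrow> K \<in> Jac I R \<Longrightarrow> J + K \<in> Jac I R"
  and deriv_on_Jac_add: "J \<in> Jac I R \<Longrightarrow> K \<in> Jac I R \<Longrightarrow> t \<in> I \<Longrightarrow>
    deriv_on I (J + K) t = deriv_on I J t + deriv_on I K t"
proof -
  assume JK: "J \<in> Jac I R" "K \<in> Jac I R"
  have 1: "((J + K) has_vector_derivative deriv_on I J t + deriv_on I K t) (at t within I)" if "t \<in> I" for t
    unfolding plus_fun_def by (intro has_vector_derivative_add Jac_derivs JK that)
  have 2: "((\<lambda>t. deriv_on I J t + deriv_on I K t) has_vector_derivative - R t ((J + K) t)) (at t within I)"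
    if "t \<in> I" for t
    using has_vector_derivative_add[OF Jac_derivs(2)[OF JK(1) that] Jac_derivs(2)[OF JK(2) that]]
    by (simp add: plus_fun_def blinfun.add_right)
  show "J + K \<in> Jac I R" by (rule JacI(1)[OF 1 2]) (simp_all add: Jac_outside JK)
  show "deriv_on I (J + K) t = deriv_on I J t + deriv_on I K t" if "t \<in> I"
    by (rule JacI(2)[OF 1 2]) (simp_all add: Jac_outside JK that)
qed

lemma Jac_scale: "J \<in> Jac I R \<Longrightarrow> c *\<^sub>R J \<in> Jac I R"
  and deriv_on_Jac_scale: "J \<in> Jac I R \<Longrightarrow> t \<in> I \<Longrightarrow> deriv_on I (c *\<^sub>R J) t = c *\<^sub>R deriv_on I J t"
proof -
  assume J: "J \<in> Jac I R"
  have 1: "((c *\<^sub>R J) has_vector_derivative c *\<^sub>R deriv_on I J t) (at t within I)" if "t \<in> I" for t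
    using Jac_derivs(1)[OF J that] unfolding scaleR_fun_def by (auto intro!: derivative_eq_intros)
  have 2: "((\<lambda>t. c *\<^sub>R deriv_on I J t) has_vector_derivative - R t ((c *\<^sub>R J) t)) (at t within I)"
    if "t \<in> I" for t
    using Jac_derivs(2)[OF J that]
    by (auto intro!: derivative_eq_intros simp: scaleR_fun_def blinfun.scaleR_right)
  show "c *\<^sub>R J \<in> Jac I R" by (rule JacI(1)[OF 1 2]) (simp_all add: Jac_outside J scaleR_fun_def)
  show "deriv_on I (c *\<^sub>R J) t = c *\<^sub>R deriv_on I J t" if "t \<in> I"
    by (rule JacI(2)[OF 1 2]) (simp_all add: Jac_outside J scaleR_fun_def that)
qed

lemma first_order_system:
  "\<exists>A :: real \<Rightarrow> ('v \<times> 'v) \<Rightarrow>\<^sub>L ('v \<times> 'v).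
    continuous_on I A \<and> (\<forall>t x y. blinfun_apply (A t) (x, y) = (y, - R t x))"
proof -
  define l where "l = Blinfun (\<lambda>x :: 'v. (x, 0 :: 'v))"
  define r where "r = Blinfun (\<lambda>x :: 'v. (0 :: 'v, x))"
  have lr: "blinfun_apply l = (\<lambda>x. (x, 0))" "blinfun_apply r = (\<lambda>x. (0, x))"
    unfolding l_def r_def
    by (intro bounded_linear_Blinfun_apply bounded_linear_Pair bounded_linear_ident bounded_linear_zero)+
  show ?thesis
  proof (intro exI conjI allI)
    \<comment> \<open>Built from compositions of bounded linear maps, so that continuity in operator
      norm follows from that of \<open>R\<close>.\<close>
    show "continuous_on I (\<lambda>t. (l o\<^sub>L snd_blinfun) - (r o\<^sub>L (R t o\<^sub>L fst_blinfun)))"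
      by (intro continuous_intros R)
    show "blinfun_apply ((l o\<^sub>L snd_blinfun) - (r o\<^sub>L (R t o\<^sub>L fst_blinfun))) (x, y) = (y, - R t x)" for t x y
      by (simp add: blinfun.diff_left lr)
  qed
qed

lemma Jac_unique:
  assumes J: "J \<in> Jac I R" and s: "s \<in> I" "J s = 0" "deriv_on I J s = 0"
  shows "J = 0"
proof
  fix t
  obtain A :: "real \<Rightarrow> ('v \<times> 'v) \<Rightarrow>\<^sub>L ('v \<times> 'v)"
    where A: "continuous_on I A" "\<And>t x y. blinfun_apply (A t) (x, y) = (y, - R t x)"
    using first_order_system by blast
  show "J t = 0 t"
  proof (cases "t \<in> I")
    case True
    let ?K = "{min s t..max s t}"
    have K: "?K \<subseteq> I"
      using mem_is_interval_1_I[OF I(1), of "min s t" "max s t"] s True by (auto simp: min_def max_def)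
    have "(J t, deriv_on I J t) = 0"
    proof (rule linear_ode_unique[of "min s t" "max s t" A "\<lambda>t. (J t, deriv_on I J t)" s])
      show "continuous_on ?K A" using A(1) K by (rule continuous_on_subset)
      fix x assume x: "x \<in> ?K"
      have "((\<lambda>t. (J t, deriv_on I J t)) has_vector_derivative (deriv_on I J x, - R x (J x))) (at x within I)"
        using x K by (intro has_vector_derivative_Pair Jac_derivs J) auto
      then show "((\<lambda>t. (J t, deriv_on I J t)) has_vector_derivative blinfun_apply (A x) (J x, deriv_on I J x)) (at x within ?K)"
        unfolding A(2) using K by (rule has_vector_derivative_within_subset)
    qed (use s in \<open>auto simp: zero_prod_def\<close>)
    then show ?thesis by (simp add: zero_prod_def zero_fun_def)
  qed (simp add: Jac_outside[OF J])
qed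

lemma Jac_exists:
  assumes s: "s \<in> I"
  shows "\<exists>J. J \<in> Jac I R \<and> J s = x \<and> deriv_on I J s = y"
proof -
  obtain A :: "real \<Rightarrow> ('v \<times> 'v) \<Rightarrow>\<^sub>L ('v \<times> 'v)"
    where A: "continuous_on I A" "\<And>t x y. blinfun_apply (A t) (x, y) = (y, - R t x)"
    using first_order_system by blast
  obtain u where u: "u s = (x, y)" "\<And>t. t \<in> I \<Longrightarrow> (u has_vector_derivative A t (u t)) (at t within I)"
    using linear_ode_exists[OF I(1) A(1) s] by blast
  \<comment> \<open>Extension by 0 gives the representative that \<open>Jac\<close> demands.\<close>
  define J where "J t = (if t \<in> I then fst (u t) else 0)" for t
  have 1: "(J has_vector_derivative snd (u t)) (at t within I)" if t: "t \<in> I" for t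
  proof -
    have "((\<lambda>t. fst (u t)) has_vector_derivative fst (A t (u t))) (at t within I)"
      by (rule bounded_linear.has_vector_derivative[OF bounded_linear_fst u(2)[OF t]])
    then have "((\<lambda>t. fst (u t)) has_vector_derivative snd (u t)) (at t within I)"
      by (cases "u t") (simp add: A(2))
    then show ?thesis
      by (rule has_vector_derivative_transform_within[OF _ zero_less_one t]) (simp add: J_def)
  qed
  have 2: "((\<lambda>t. snd (u t)) has_vector_derivative - R t (J t)) (at t within I)" if t: "t \<in> I" for t
  proof -
    have "((\<lambda>t. snd (u t)) has_vector_derivative snd (A t (u t))) (at t within I)"
      by (rule bounded_linear.has_vector_derivative[OF bounded_linear_snd u(2)[OF t]])
    then show ?thesis by (cases "u t") (simp add: A(2) J_def t)
  qed
  have "J \<in> Jac I R" by (rule JacI(1)[OF 1 2]) (simp_all add: J_def)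
  moreover have "deriv_on I J s = snd (u s)" by (rule JacI(2)[OF 1 2 _ s]) (simp_all add: J_def)
  ultimately show ?thesis using u(1) s by (intro exI[of _ J]) (simp add: J_def)
qed

text \<open>Cauchy data at \<open>s\<close> carry the fields to the Euclidean space V x V, where the
  linear algebra above applies.\<close>

lemma Jac_parametrization:
  assumes s: "s \<in> I"
  obtains \<Phi> :: "'v \<times> 'v \<Rightarrow> real \<Rightarrow> 'v" where "linear \<Phi>" "inj \<Phi>" "range \<Phi> = Jac I R"
proof -
  define \<Phi> where "\<Phi> p = (SOME J. J \<in> Jac I R \<and> J s = fst p \<and> deriv_on I J s = snd p)" for p
  have P: "\<Phi> p \<in> Jac I R" "\<Phi> p s = fst p" "deriv_on I (\<Phi> p) s = snd p" for p
    using someI_ex[OF Jac_exists[OF s, of "fst p" "snd p"]] unfolding \<Phi>_def[symmetric] by auto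
  have eq: "J = K" if JK: "J \<in> Jac I R" "K \<in> Jac I R" "J s = K s" "deriv_on I J s = deriv_on I K s" for J K
  proof -
    have K': "- 1 *\<^sub>R K \<in> Jac I R" using JK by (intro Jac_scale)
    have "J + - 1 *\<^sub>R K = 0"
    proof (rule Jac_unique[OF Jac_add[OF JK(1) K'] s])
      show "(J + - 1 *\<^sub>R K) s = 0"
        by (simp only: plus_fun_def scaleR_fun_def JK(3)) simp
      show "deriv_on I (J + - 1 *\<^sub>R K) s = 0"
        by (simp only: deriv_on_Jac_add[OF JK(1) K' s] deriv_on_Jac_scale[OF JK(2) s] JK(4)) simp
    qed
    then show ?thesis by simp
  qed
  show thesis
  proof (rule that)
    show "linear \<Phi>"
    proof (rule linearI)
      show "\<Phi> (p + q) = \<Phi> p + \<Phi> q" for p q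
        by (rule eq) (simp_all add: P Jac_add deriv_on_Jac_add[OF P(1) P(1) s])
      show "\<Phi> (c *\<^sub>R p) = c *\<^sub>R \<Phi> p" for c p
        by (rule eq) (simp_all add: P Jac_scale deriv_on_Jac_scale[OF P(1) s], simp add: scaleR_fun_def P)
    qed
    show "inj \<Phi>" using P(2,3) by (metis injI prod_eqI)
    show "range \<Phi> = Jac I R"
    proof (intro equalityI subsetI)
      fix J assume J: "J \<in> Jac I R"
      have "J = \<Phi> (J s, deriv_on I J s)" by (rule eq) (simp_all add: P J)
      then show "J \<in> range \<Phi>" by blast
    qed (use P in auto)
  qed
qed

text \<open>The count for \<open>lag\<close> subspaces is pulled back along the parametrization,
  whose injectivity preserves dimensions; \<open>L1\<close> plays the role of \<open>B\<close> and
  \<open>L2\<close> that of \<open>A\<close>.\<close>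

lemma focal_index_sum_le:
  assumes sym: "\<And>t x y. t \<in> I \<Longrightarrow> R t x \<bullet> y = x \<bullet> R t y"
    and L: "lagrangian I R L1" "lagrangian I R L2"
    and I0: "is_interval I0" "I0 \<subseteq> I" and G: "finite G" "G \<subseteq> I0"
    and nf: "\<And>t. t \<in> I0 - G \<Longrightarrow> focal_index L2 t = 0"
    and F: "finite F" "F \<subseteq> I0"
  shows "(\<Sum>t\<in>F. focal_index L1 t) + dim (L1 \<inter> L2) \<le> (\<Sum>t\<in>G. focal_index L2 t) + DIM('v)"
proof -
  obtain s where s: "s \<in> I" using I(2) interior_subset by blast
  obtain \<Phi> :: "'v \<times> 'v \<Rightarrow> real \<Rightarrow> 'v" where P: "linear \<Phi>" "inj \<Phi>" "range \<Phi> = Jac I R"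
    by (rule Jac_parametrization[OF s])
  have PJ: "\<Phi> p \<in> Jac I R" for p using P(3) by blast
  interpret P: linear \<Phi> by fact
  interpret symplectic_flow I "\<lambda>t p. \<Phi> p t" "\<lambda>t p. deriv_on I (\<Phi> p) t" "\<lambda>p q. omega I (\<Phi> p) (\<Phi> q)"
  proof
    fix t assume t: "t \<in> I"
    show "((\<lambda>s. \<Phi> p s) has_vector_derivative deriv_on I (\<Phi> p) t) (at t within I)" for p
      by (rule Jac_derivs(1)[OF PJ t])
    show "p = 0" if "\<Phi> p t = 0" "deriv_on I (\<Phi> p) t = 0" for p
      using Jac_unique[OF PJ t that] P(2) P.zero by (metis injD)
    show "omega I (\<Phi> p) (\<Phi> q) = \<Phi> p t \<bullet> deriv_on I (\<Phi> q) t - deriv_on I (\<Phi> p) t \<bullet> \<Phi> q t" for p q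
      by (rule omega_eq[OF I(1) sym PJ PJ t])
    show "\<Phi> (p + q) t = \<Phi> p t + \<Phi> q t" "\<Phi> (c *\<^sub>R p) t = c *\<^sub>R \<Phi> p t" for p q c
      by (simp_all add: P.add P.scale scaleR_fun_def)
    show "deriv_on I (\<Phi> (p + q)) t = deriv_on I (\<Phi> p) t + deriv_on I (\<Phi> q) t"
      "deriv_on I (\<Phi> (c *\<^sub>R p)) t = c *\<^sub>R deriv_on I (\<Phi> p) t" for p q c
      by (simp_all add: P.add P.scale deriv_on_Jac_add deriv_on_Jac_scale PJ t)
  qed
  have dim_image: "dim (\<Phi> ` S) = dim S" for S
    using P(2) by (intro dim_image_eq[OF P(1)] inj_on_subset[OF P(2)]) simp
  have img: "\<Phi> ` (\<Phi> -` L) = L" if "lagrangian I R L" for L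
  proof -
    have "L \<subseteq> Jac I R" using that unfolding lagrangian_def by (elim conjE)
    then show ?thesis by (simp add: image_vimage_eq P(3) Int_absorb2)
  qed
  have lag: "lag (\<Phi> -` L)" if L: "lagrangian I R L" for L
  proof -
    have "subspace L" using L unfolding lagrangian_def by (elim conjE)
    have Lo: "L = omega_compl I R L" using L unfolding lagrangian_def by (elim conjE)
    have "subspace (\<Phi> -` L)" using P(1) \<open>subspace L\<close> by (rule linear_subspace_vimage)
    moreover have "p \<in> \<Phi> -` L \<longleftrightarrow> (\<forall>q\<in>\<Phi> -` L. omega I (\<Phi> p) (\<Phi> q) = 0)" for p
    proof -
      have "\<Phi> p \<in> L \<longleftrightarrow> \<Phi> p \<in> omega_compl I R L"
        using arg_cong[OF Lo, of "\<lambda>X. \<Phi> p \<in> X"] .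
      also have "\<dots> \<longleftrightarrow> (\<forall>K\<in>L. omega I (\<Phi> p) K = 0)"
        by (simp add: omega_compl_def PJ)
      also have "\<dots> \<longleftrightarrow> (\<forall>q\<in>\<Phi> -` L. omega I (\<Phi> p) (\<Phi> q) = 0)"
        by (subst img[OF L, symmetric]) blast
      finally show ?thesis by simp
    qed
    ultimately show ?thesis unfolding lag_def by blast
  qed
  have foc: "focal_index L t = dim (vanishing (\<Phi> -` L) t)" if L: "lagrangian I R L" for L t
  proof -
    have "{J \<in> L. J t = 0} = \<Phi> ` vanishing (\<Phi> -` L) t"
      using img[OF L] by (auto simp: vanishing_def)
    then show ?thesis by (simp add: focal_index_def dim_image)
  qed
  have "L1 \<inter> L2 = \<Phi> ` (\<Phi> -` L1 \<inter> \<Phi> -` L2)"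
    by (simp only: image_Int[OF P(2)] img L)
  then have d: "dim (L1 \<inter> L2) = dim (\<Phi> -` L1 \<inter> \<Phi> -` L2)" by (simp add: dim_image)
  have "(\<Sum>t\<in>F. dim (vanishing (\<Phi> -` L1) t)) + dim (\<Phi> -` L1 \<inter> \<Phi> -` L2)
      \<le> (\<Sum>t\<in>G. dim (vanishing (\<Phi> -` L2) t)) + dim (\<Phi> -` L1)"
    using nf foc[OF L(2)] by (intro sum_vanishing_le[OF lag lag I0 G _ F] L) auto
  then show ?thesis
    by (simp add: foc[OF L(1)] foc[OF L(2)] d dim_lag[OF lag[OF L(1)] s])
qed

end

text \<open>Both indices may be infinite, so that of \<open>L2\<close> is moved to the right-hand
  side instead of forming a difference.\<close>

theorem proposition4p1:
  fixes R :: "real \<Rightarrow> 'v::euclidean_space \<Rightarrow>\<^sub>L 'v"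
    and I I0 :: "real set"
    and L1 L2 :: "(real \<Rightarrow> 'v) set"
  assumes "is_interval I" and "interior I \<noteq> {}"
    and "smooth_on I R"
    and "\<And>t x y. t \<in> I \<Longrightarrow> blinfun_apply (R t) x \<bullet> y = x \<bullet> blinfun_apply (R t) y"
    and "lagrangian I R L1" and "lagrangian I R L2"
    and "is_interval I0" and "I0 \<subseteq> I"
  shows "ind L1 I0 \<le> ind L2 I0 + ereal (real DIM('v) - real (dim (L1 \<inter> L2)))"
proof (cases "ind L2 I0 = \<infinity>")
  case False
  have R: "continuous_on I R"
    using assms(3)[unfolded smooth_on_def, rule_format, of 0]
    by (auto intro: differentiable_imp_continuous_on)
  have ind: "ind L I0 = (SUP F\<in>{F. finite F \<and> F \<subseteq> I0}. ereal (\<Sum>t\<in>F. real (focal_index L t)))"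
    for L :: "(real \<Rightarrow> 'v) set"
    unfolding ind_def by (subst nonneg_infsum_complete) auto
  have le: "ereal (\<Sum>t\<in>F. real (focal_index L2 t)) \<le> ind L2 I0" if "finite F" "F \<subseteq> I0" for F
    unfolding ind using that by (intro SUP_upper) auto
  obtain r where r: "ind L2 I0 = ereal r"
    using False le[of "{}"] by (cases "ind L2 I0") auto
  define G where "G = {t \<in> I0. focal_index L2 t \<noteq> 0}"
  have "finite G"
  proof (rule ccontr)
    assume "infinite G"
    \<comment> \<open>More than \<open>r\<close> focal times, each contributing at least 1, would
      exceed the total index \<open>r\<close>.\<close>
    then obtain F where F: "finite F" "card F = Suc (nat \<lceil>r\<rceil>)" "F \<subseteq> G"
      using infinite_arbitrarily_large by blast
    have "real (card F) = (\<Sum>t\<in>F. 1)" by simp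
    also have "\<dots> \<le> (\<Sum>t\<in>F. real (focal_index L2 t))"
      using F(3) by (intro sum_mono) (auto simp: G_def Suc_le_eq)
    also have "\<dots> \<le> r"
      using le[of F] F by (auto simp: r G_def)
    finally show False using F(2) by linarith
  qed
  show ?thesis
  proof (subst ind[of L1], rule SUP_least)
    fix F assume "F \<in> {F. finite F \<and> F \<subseteq> I0}"
    then have F: "finite F" "F \<subseteq> I0" by auto
    have "(\<Sum>t\<in>F. focal_index L1 t) + dim (L1 \<inter> L2) \<le> (\<Sum>t\<in>G. focal_index L2 t) + DIM('v)"
      by (rule focal_index_sum_le[OF assms(1,2) R assms(4-8) \<open>finite G\<close> _ _ F]) (auto simp: G_def)
    then have "real ((\<Sum>t\<in>F. focal_index L1 t) + dim (L1 \<inter> L2)) \<le> real ((\<Sum>t\<in>G. focal_index L2 t) + DIM('v))"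
      by (rule of_nat_mono)
    moreover have "(\<Sum>t\<in>G. real (focal_index L2 t)) \<le> r"
      using le[of G] \<open>finite G\<close> by (auto simp: r G_def)
    ultimately show "ereal (\<Sum>t\<in>F. real (focal_index L1 t))
        \<le> ind L2 I0 + ereal (real DIM('v) - real (dim (L1 \<inter> L2)))"
      by (simp add: r)
  qed
qed simp

end
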